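(* Let $0<\eta,\mu\le 1$, let $A>0$, and let $f\in\mathbb{Z}[x]$ be an $(\eta,\mu)$-shrinking polynomial of degree $d$. For a positive integer $N$ let $f_N=f(\mathbb{N})\cap\{1,2,\dots,N\}$, and let $H_{A,d}(f_N)$ be the minimum of $T\sum_{i=1}^T|X_i|$ over all $T$ and all systems $X_1,\dots,X_T\subseteq\{1,2,\dots,N\}$ such that $\bigcup_{i=1}^T X_i\supseteq f_N$ and each $X_i$ is a CP-$\{D_i,(D_i+1)_{\log^A N}\}$ quasi progression for some positive integer $D_i$. Then, as $N\to\infty$ (with $f,\eta,\mu,A$ fixed), $$H_{A,d}(f_N)\ \ge\ (1+o(1))\,\frac{C'\,N^{2/d}}{\log^{A+2}N},\qquad\text{where } C'=\frac{(1-\mu)^2\eta^2}{200}.$$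
   Context: A set of primes $P'=\{p_1<p_2<\dots\}$ is called $\eta$-dense (for $\eta>0$) if $|P'\cap[1,x]|/\pi(x)>\eta$ for every sufficiently large $x$, where $\pi(x)$ is the number of primes up to $x$. A polynomial $f\in\mathbb{Z}[x]$ is called $(\eta,\mu)$-shrinking if there is an $\eta$-dense sequence of primes $P'=\{p_1<p_2<\dots\}$ such that for all sufficiently large $i$ one has $|f(\mathbb{F}_{p_i})|<\mu p_i$, where $f(\mathbb{F}_{p}):=\{f(x):x\in\mathbb{F}_{p}\}$ (with $f$ reduced modulo $p$). A finite set $X=\{x_1<x_2<\dots<x_k\}$ ($k\ge 1$) of integers is a CP-$\{D,D+1\}$ quasi progression, where $D$ is a positive integer, if $x_{i+1}-x_i\in\{D,D+1\}$ for every $1\le i\le k-1$. It is a CP-$\{D,(D+1)_{\log^A N}\}$ quasi progression if in addition the number of indices $i$ with $x_{i+1}-x_i=D+1$ is at most $\log^A N$. The integers $D_i$ may differ for different $i$. Here $\log^A N=(\log N)^A$ and $\log$ is the natural logarithm.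
   Formalization: The polynomial f is assumed to have degree d ≥ 1 (so that N^{2/d} is defined) and positive leading coefficient; with a negative one f_N stays bounded and the bound fails for μ<1 (e.g. f = −x², η = 1/2, μ = 3/4). *)

theory Defs
  imports Complex_Main "HOL-Computational_Algebra.Computational_Algebra" "HOL-Library.Infinite_Set"
begin

definition prime_pi :: "real \<Rightarrow> nat" where
  "prime_pi x = card {p::nat. prime p \<and> real p \<le> x}"

definition eta_dense :: "real \<Rightarrow> nat set \<Rightarrow> bool" where
  "eta_dense \<eta> P \<longleftrightarrow> infinite P \<and> (\<forall>p\<in>P. prime p) \<and>
     (\<forall>\<^sub>F x::real in at_top. real (card {p\<in>P. real p \<le> x}) / real (prime_pi x) > \<eta>)"

text \<open>The image of the reduction of \<open>f\<close> modulo \<open>p\<close> on the field of \<open>p\<close> elements,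
  whose elements are represented by \<open>0, \<dots>, p - 1\<close>.\<close>
definition poly_image_mod :: "int poly \<Rightarrow> nat \<Rightarrow> int set" where
  "poly_image_mod f p = (\<lambda>x. poly f x mod int p) ` {0..<int p}"

text \<open>\<^term>\<open>enumerate P\<close> lists the infinite set \<open>P\<close> in increasing order, starting at index \<open>0\<close>.\<close>
definition shrinking :: "real \<Rightarrow> real \<Rightarrow> int poly \<Rightarrow> bool" where
  "shrinking \<eta> \<mu> f \<longleftrightarrow> (\<exists>P. eta_dense \<eta> P \<and>
     (\<forall>\<^sub>F i in sequentially.
        real (card (poly_image_mod f (enumerate P i))) < \<mu> * real (enumerate P i)))"

definition gap :: "int set \<Rightarrow> nat \<Rightarrow> int" where
  "gap X i = sorted_list_of_set X ! Suc i - sorted_list_of_set X ! i"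

definition cp_qp :: "nat \<Rightarrow> int set \<Rightarrow> bool" where
  "cp_qp D X \<longleftrightarrow> D > 0 \<and> finite X \<and> X \<noteq> {} \<and>
     (\<forall>i. Suc i < card X \<longrightarrow> gap X i \<in> {int D, int D + 1})"

definition cp_qp_log :: "real \<Rightarrow> nat \<Rightarrow> nat \<Rightarrow> int set \<Rightarrow> bool" where
  "cp_qp_log A N D X \<longleftrightarrow> cp_qp D X \<and>
     real (card {i. Suc i < card X \<and> gap X i = int D + 1}) \<le> ln (real N) powr A"

definition qp_cover :: "real \<Rightarrow> nat \<Rightarrow> int set \<Rightarrow> nat \<Rightarrow> (nat \<Rightarrow> int set) \<Rightarrow> bool" where
  "qp_cover A N S T X \<longleftrightarrow> S \<subseteq> (\<Union>i\<in>{1..T}. X i) \<and>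
     (\<forall>i\<in>{1..T}. X i \<subseteq> {1..int N} \<and> (\<exists>D. cp_qp_log A N D (X i)))"

text \<open>The empty system (\<open>T = 0\<close>) covers the empty set; for nonempty \<open>S\<close> it plays no role.\<close>
definition H :: "real \<Rightarrow> nat \<Rightarrow> int set \<Rightarrow> nat" where
  "H A N S = (LEAST h. \<exists>T X. qp_cover A N S T X \<and> h = T * (\<Sum>i=1..T. card (X i)))"

text \<open>The natural numbers are taken to start at \<open>1\<close>. Since \<open>H\<close> is monotone in the covered set,
  lower bounds for this set also hold when the value at \<open>0\<close> is included.\<close>
definition values_upto :: "int poly \<Rightarrow> nat \<Rightarrow> int set" where
  "values_upto f N = {poly f (int n) | n::nat. n \<ge> 1} \<inter> {1..int N}"

lemma qp_cover_exists:
  assumes "S \<subseteq> {1..int N}"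
  shows "\<exists>T X. qp_cover A N S T X"
proof -
  have fin: "finite S" using assms finite_subset by blast
  then obtain g where g: "bij_betw g {1..card S} S"
    using ex_bij_betw_nat_finite_1 by blast
  have "qp_cover A N S (card S) (\<lambda>i. {g i})"
    unfolding qp_cover_def
  proof (intro conjI ballI)
    show "S \<subseteq> (\<Union>i\<in>{1..card S}. {g i})"
      using g by (auto simp: bij_betw_def)
    fix i assume "i \<in> {1..card S}"
    then have "g i \<in> S"
      using g by (auto simp: bij_betw_def)
    then show "{g i} \<subseteq> {1..int N}"
      using assms by blast
    show "\<exists>D. cp_qp_log A N D {g i}"
      by (rule exI[of _ 1]) (simp add: cp_qp_log_def cp_qp_def)
  qed
  then show ?thesis by blast
qed

text \<open>Hence the minimum in the definition of \<open>H\<close> is attained.\<close>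
lemma H_attained:
  assumes "S \<subseteq> {1..int N}"
  shows "\<exists>T X. qp_cover A N S T X \<and> H A N S = T * (\<Sum>i=1..T. card (X i))"
  unfolding H_def by (rule LeastI_ex) (use qp_cover_exists[OF assms] in blast)

end

theory Submission
  imports Defs "HOL-Analysis.Analysis" "HOL-Number_Theory.Totient" "HOL-Real_Asymp.Real_Asymp"
begin

text \<open>
  A progression \<open>b + D n\<close>, \<open>1 \<le> n \<le> M\<close>, meets the values of \<open>f\<close> in a set whose indices \<open>n\<close> miss a
  proportion \<open>1 - \<mu>\<close> of the classes modulo every prime \<open>p\<close> of a dense set with \<open>p\<close> not dividing \<open>D\<close>, so
  the large sieve bounds its size by roughly \<open>sqrt M * ln M\<close>. A quasi progression with at most \<open>L\<close> long
  steps splits into \<open>L + 1\<close> progressions, and two applications of the Cauchy-Schwarz inequality turn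
  a bound \<open>K * sqrt M\<close> per progression into \<open>|f_N|^2 \<le> K^2 * (L + 1) * T * (\<Sum>i. |X_i|)\<close>.

  Since \<open>|f_N|\<close> is proportional to \<open>(N / a)^(1/d)\<close> with \<open>a\<close> the leading coefficient, while the constant of
  the theorem does not depend on \<open>a\<close>, the bound per progression is needed in the form
  \<open>\<delta> * sqrt M * ln N\<close> with \<open>\<delta>\<close> arbitrarily small. If \<open>M \<le> \<delta>^2 * (ln N)^2\<close>, this is trivial; if
  \<open>M \<le> N^\<theta>\<close>, sieving by primes suffices because \<open>ln M \<le> \<theta> * ln N\<close>; if \<open>M\<close> is larger, sieving by
  products \<open>p q\<close> of two primes gains the factor \<open>\<Sum>p. 1 / p\<close>, which tends to infinity.
\<close>

section \<open>Exponential sums and the large sieve inequality\<close>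

text \<open>What forces the case distinction is the common difference \<open>D\<close>: it is
  bounded only by \<open>N\<close>, so the estimate for its number of prime divisors is of order
  \<open>ln N\<close>, and these primes are lost to the sieve. Only from about
  \<open>(ln N) powr (3/2)\<close> on do the remaining primes keep a count of order
  \<open>n / ln n\<close>, so a short progression may not have enough moduli of its own.

  Products \<open>p q\<close> help because the large sieve accepts all moduli up to
  \<open>Q = sqrt M\<close>. Primes supply about \<open>Q / ln Q\<close> of them, whereas every
  small prime \<open>p\<close> supplies a further multiple of \<open>(Q / p) / ln Q\<close>
  products, each at the cost of only a fixed factor \<open>(1 - \<mu>)^2\<close>. With small primes
  running up to a power of \<open>N\<close> and counts valid only from
  \<open>(ln N) powr (3/2)\<close> on, the lower bound for the sum of \<open>1 / p\<close> is of
  order \<open>ln ln N - ln ln ln N\<close>, which is still unbounded.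

  Since \<open>\<delta>\<close> is free, it absorbs every constant depending on \<open>f\<close>,
  \<open>\<eta>\<close> and \<open>\<mu>\<close>. For \<open>\<mu> < 1\<close> the argument
  therefore reaches any prescribed constant, in particular \<open>C'\<close>, with the error term
  equal to \<open>0\<close>.\<close>

definition ee :: "real \<Rightarrow> complex" where
  "ee x = cis (2 * pi * x)"

lemma ee_add: "ee (x + y) = ee x * ee y"
  by (simp add: ee_def cis_mult algebra_simps)

lemma ee_0 [simp]: "ee 0 = 1"
  by (simp add: ee_def)

lemma norm_ee [simp]: "cmod (ee x) = 1"
  by (simp add: ee_def)

lemma cnj_ee: "cnj (ee x) = ee (- x)"
  by (simp add: ee_def cis_cnj)

lemma ee_power: "ee (real n * x) = ee x ^ n"
proof -
  have "real n * (2 * pi * x) = 2 * pi * (real n * x)" by simp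
  then show ?thesis by (simp only: ee_def Complex.DeMoivre)
qed

lemma ee_Ints: "x \<in> \<int> \<Longrightarrow> ee x = 1"
  by (simp add: ee_def)

lemma ee_add_Ints: "k \<in> \<int> \<Longrightarrow> ee (x + k) = ee x"
  by (simp add: ee_add ee_Ints)

section \<open>Geometric sums of characters at well-spaced rational points\<close>

lemma norm_one_minus_ee: "cmod (1 - ee x) = 2 * \<bar>sin (pi * x)\<bar>"
proof -
  have c: "cos (2 * (pi * x)) = 1 - 2 * (sin (pi * x))\<^sup>2" by (rule cos_double_sin)
  have "(cmod (1 - ee x))\<^sup>2 = (1 - cos (2 * (pi * x)))\<^sup>2 + (sin (2 * (pi * x)))\<^sup>2"
    by (simp add: ee_def cmod_power2 algebra_simps)
  also have "\<dots> = 2 - 2 * cos (2 * (pi * x))"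
    using sin_cos_squared_add[of "2 * (pi * x)"] by (simp add: power2_eq_square algebra_simps)
  also have "\<dots> = (2 * \<bar>sin (pi * x)\<bar>)\<^sup>2"
    by (simp add: c power_mult_distrib)
  finally show ?thesis
    by (subst (asm) power2_eq_iff_nonneg) auto
qed

lemma norm_geometric_ee_le:
  assumes "sin (pi * x) \<noteq> 0"
  shows "(cmod (\<Sum>i<K. ee (real i * x)))\<^sup>2 \<le> 1 / (sin (pi * x))\<^sup>2"
proof -
  have "(1 - ee x) * (\<Sum>i<K. ee x ^ i) = 1 - ee x ^ K"
    by (rule one_diff_power_eq[symmetric])
  then have "cmod (1 - ee x) * cmod (\<Sum>i<K. ee (real i * x)) = cmod (1 - ee x ^ K)"
    by (simp add: ee_power flip: norm_mult)
  also have "\<dots> \<le> cmod 1 + cmod (ee x ^ K)" by (rule norm_triangle_ineq4)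
  also have "\<dots> = 2" by (simp add: norm_power)
  finally have "\<bar>sin (pi * x)\<bar> * cmod (\<Sum>i<K. ee (real i * x)) \<le> 1"
    by (simp add: norm_one_minus_ee)
  then have "cmod (\<Sum>i<K. ee (real i * x)) \<le> 1 / \<bar>sin (pi * x)\<bar>"
    using assms by (simp add: field_simps)
  then have "(cmod (\<Sum>i<K. ee (real i * x)))\<^sup>2 \<le> (1 / \<bar>sin (pi * x)\<bar>)\<^sup>2"
    by (intro power_mono) auto
  then show ?thesis by (simp add: power_divide)
qed

text \<open>Put \<open>t = pi * x\<close>; then \<open>t \<le> 2\<close> because
  \<open>pi < 4\<close>. The cubic Taylor bound gives
  \<open>sin t \<ge> t - t^3 / 6 \<ge> t / 3\<close>, and \<open>pi > 3\<close> turns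
  \<open>t / 3\<close> into \<open>x\<close>.\<close>

lemma sin_pi_ge:
  assumes "0 \<le> x" "x \<le> 1/2"
  shows "x \<le> sin (pi * x)"
proof -
  define t where "t = pi * x"
  have "pi * x \<le> 4 * (1 / 2)" using assms pi_less_4 by (intro mult_mono) auto
  then have t: "0 \<le> t" "t \<le> 2" using assms by (auto simp: t_def)
  have "\<bar>sin t - t\<bar> \<le> t ^ 3 / 6"
    using Maclaurin_sin_bound[of t 3] t
    by (simp add: numeral_3_eq_3 sin_coeff_def fact_numeral)
  then have "t - t ^ 3 / 6 \<le> sin t" by linarith
  moreover have "t ^ 3 \<le> t * 4"
  proof -
    have "t\<^sup>2 \<le> 2\<^sup>2" using t by (intro power_mono) auto
    then have "t * t\<^sup>2 \<le> t * 4" using t by (intro mult_left_mono) auto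
    then show ?thesis by (simp add: power3_eq_cube power2_eq_square)
  qed
  moreover have "3 * x \<le> t" using pi_gt3 assms unfolding t_def by (intro mult_right_mono) auto
  ultimately show ?thesis unfolding t_def by linarith
qed

text \<open>The nearest integer to \<open>x\<close> is \<open>-1\<close>, \<open>0\<close> or
  \<open>1\<close>, and \<open>\<bar>sin (pi * x)\<bar>\<close> is at least the distance to it.
  Summing over all three shifts avoids naming the nearest one and replaces distances on the circle
  by distances on the line.\<close>

lemma inverse_sin_squared_le:
  assumes "\<bar>x\<bar> < 1" "x \<noteq> 0"
  shows "sin (pi * x) \<noteq> 0 \<and> 1 / (sin (pi * x))\<^sup>2 \<le> (\<Sum>k\<in>{-1,0,1::real}. 1 / (x + k)\<^sup>2)"
proof -
  have S: "(\<Sum>k\<in>{-1,0,1::real}. 1 / (x + k)\<^sup>2) = 1 / (x - 1)\<^sup>2 + 1 / x\<^sup>2 + 1 / (x + 1)\<^sup>2"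
    by simp
  have *: "sin (pi * x) \<noteq> 0 \<and> 1 / (sin (pi * x))\<^sup>2 \<le> 1 / y\<^sup>2"
    if "0 < y" "y \<le> 1/2" "\<bar>sin (pi * x)\<bar> = sin (pi * y)" for y
  proof -
    have "y \<le> \<bar>sin (pi * x)\<bar>" using sin_pi_ge[of y] that by simp
    then have "y\<^sup>2 \<le> (sin (pi * x))\<^sup>2" using abs_le_square_iff[of y "sin (pi * x)"] that by simp
    then show ?thesis using that \<open>y \<le> \<bar>sin (pi * x)\<bar>\<close> by (auto intro!: divide_left_mono)
  qed
  have nn: "0 \<le> 1 / (x - 1)\<^sup>2" "0 \<le> 1 / x\<^sup>2" "0 \<le> 1 / (x + 1)\<^sup>2" by auto
  consider "0 < x" "x \<le> 1/2" | "1/2 < x" | "x < 0" "-1/2 \<le> x" | "x < -1/2"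
    using assms by linarith
  then show ?thesis
  proof cases
    case 1
    then have "\<bar>sin (pi * x)\<bar> = sin (pi * x)" using sin_pi_ge[of x] by simp
    then show ?thesis using *[of x] 1 nn unfolding S by linarith
  next
    case 2
    have "sin (pi * x) = sin (pi * (1 - x))" by (simp add: algebra_simps)
    then have "\<bar>sin (pi * x)\<bar> = sin (pi * (1 - x))" using sin_pi_ge[of "1 - x"] 2 assms by simp
    then have "sin (pi * x) \<noteq> 0 \<and> 1 / (sin (pi * x))\<^sup>2 \<le> 1 / (1 - x)\<^sup>2"
      using 2 assms by (intro *) auto
    moreover have "(1 - x)\<^sup>2 = (x - 1)\<^sup>2" by (rule power2_commute)
    ultimately have "sin (pi * x) \<noteq> 0 \<and> 1 / (sin (pi * x))\<^sup>2 \<le> 1 / (x - 1)\<^sup>2" by simp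
    then show ?thesis using nn unfolding S by linarith
  next
    case 3
    then have "\<bar>sin (pi * x)\<bar> = sin (pi * (- x))" using sin_pi_ge[of "- x"] by simp
    then have "sin (pi * x) \<noteq> 0 \<and> 1 / (sin (pi * x))\<^sup>2 \<le> 1 / (- x)\<^sup>2"
      using 3 by (intro *) auto
    then have "sin (pi * x) \<noteq> 0 \<and> 1 / (sin (pi * x))\<^sup>2 \<le> 1 / x\<^sup>2" by simp
    then show ?thesis using nn unfolding S by linarith
  next
    case 4
    have "sin (pi * x) = - sin (pi * (1 + x))" by (simp add: algebra_simps)
    then have "\<bar>sin (pi * x)\<bar> = sin (pi * (1 + x))" using sin_pi_ge[of "1 + x"] 4 assms by simp
    then have "sin (pi * x) \<noteq> 0 \<and> 1 / (sin (pi * x))\<^sup>2 \<le> 1 / (1 + x)\<^sup>2"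
      using 4 assms by (intro *) auto
    then have "sin (pi * x) \<noteq> 0 \<and> 1 / (sin (pi * x))\<^sup>2 \<le> 1 / (x + 1)\<^sup>2" by (simp add: add.commute)
    then show ?thesis using nn unfolding S by linarith
  qed
qed

lemma sum_inverse_squares_le_2: "(\<Sum>j=1..m. 1 / (real j)\<^sup>2) \<le> 2"
proof -
  \<comment> \<open>The induction carries the stronger bound \<open>2 - 1 / m\<close>, because the
    new term is at most \<open>1 / m - 1 / (m + 1)\<close>.\<close>
  have "(\<Sum>j=1..m. 1 / (real j)\<^sup>2) \<le> 2 - 1 / real m" if "m \<ge> 1"
    using that
  proof (induction m rule: dec_induct)
    case (step m)
    have m: "real m > 0" using step by simp
    have "1 / (real (Suc m))\<^sup>2 \<le> 1 / (real m * real (Suc m))"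
      using m by (intro divide_left_mono) (auto simp: power2_eq_square)
    also have "\<dots> = 1 / real m - 1 / real (Suc m)"
      using m by (simp add: divide_simps)
    finally show ?case using step by simp
  qed simp
  then show ?thesis by (cases "m = 0") (auto intro: order_trans)
qed

text \<open>Spacing makes \<open>w \<mapsto> \<lfloor>w / \<delta>\<rfloor>\<close> injective into
  the positive integers, and \<open>w\<close> is at least \<open>\<delta>\<close> times its image;
  so the sum is dominated by \<open>1 / \<delta>^2\<close> times a sum of
  \<open>1 / j^2\<close>.\<close>

lemma sum_inverse_squares_spaced_pos:
  fixes W :: "real set"
  assumes "finite W" "\<delta> > 0" "\<And>w. w \<in> W \<Longrightarrow> \<delta> \<le> w"
    and "\<And>w v. w \<in> W \<Longrightarrow> v \<in> W \<Longrightarrow> w \<noteq> v \<Longrightarrow> \<delta> \<le> \<bar>w - v\<bar>"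
  shows "(\<Sum>w\<in>W. 1 / w\<^sup>2) \<le> 2 / \<delta>\<^sup>2"
proof -
  define j where "j = (\<lambda>w. nat \<lfloor>w / \<delta>\<rfloor>)"
  have j: "real (j w) = of_int \<lfloor>w / \<delta>\<rfloor>" "j w \<ge> 1" if "w \<in> W" for w
  proof -
    have "1 \<le> w / \<delta>" using assms(2) assms(3)[OF that] by simp
    then have "1 \<le> \<lfloor>w / \<delta>\<rfloor>" by simp
    then show "real (j w) = of_int \<lfloor>w / \<delta>\<rfloor>" "j w \<ge> 1" unfolding j_def by linarith+
  qed
  have inj: "inj_on j W"
  proof (rule inj_onI, rule ccontr)
    fix w v assume *: "w \<in> W" "v \<in> W" "j w = j v" "w \<noteq> v"
    then have "\<lfloor>w / \<delta>\<rfloor> = \<lfloor>v / \<delta>\<rfloor>" using j(1)[of w] j(1)[of v] by simp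
    then have "\<bar>w / \<delta> - v / \<delta>\<bar> < 1" by linarith
    then have "\<bar>w - v\<bar> < \<delta>" using assms(2) by (simp add: field_simps abs_if split: if_splits)
    then show False using assms(4)[of w v] * by auto
  qed
  have "(\<Sum>w\<in>W. 1 / w\<^sup>2) \<le> (\<Sum>w\<in>W. 1 / \<delta>\<^sup>2 * (1 / (real (j w))\<^sup>2))"
  proof (rule sum_mono)
    fix w assume w: "w \<in> W"
    have "real (j w) \<le> w / \<delta>" using j(1)[OF w] by simp
    then have "\<delta> * real (j w) \<le> w" using assms(2) by (simp add: field_simps)
    then have "(\<delta> * real (j w))\<^sup>2 \<le> w\<^sup>2" using assms(2) by (intro power_mono) auto
    then have "1 / w\<^sup>2 \<le> 1 / (\<delta> * real (j w))\<^sup>2"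
      using assms(2,3) w j(2)[OF w] by (intro divide_left_mono mult_pos_pos zero_less_power) force+
    then show "1 / w\<^sup>2 \<le> 1 / \<delta>\<^sup>2 * (1 / (real (j w))\<^sup>2)" by (simp add: power_mult_distrib)
  qed
  also have "\<dots> = 1 / \<delta>\<^sup>2 * (\<Sum>i\<in>j ` W. 1 / (real i)\<^sup>2)"
    using inj by (simp add: sum.reindex sum_distrib_left)
  also have "(\<Sum>i\<in>j ` W. 1 / (real i)\<^sup>2) \<le> (\<Sum>i=1..Max (insert 1 (j ` W)). 1 / (real i)\<^sup>2)"
    using assms(1) j(2) by (intro sum_mono2) (auto intro!: Max_ge)
  also have "\<dots> \<le> 2" by (rule sum_inverse_squares_le_2)
  finally show ?thesis using assms(2) by (simp add: mult_left_mono divide_right_mono)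
qed

lemma sum_inverse_squares_spaced:
  fixes Y :: "real set"
  assumes "finite Y" "\<delta> > 0" "y \<in> Y"
    and sp: "\<And>w v. w \<in> Y \<Longrightarrow> v \<in> Y \<Longrightarrow> w \<noteq> v \<Longrightarrow> \<delta> \<le> \<bar>w - v\<bar>"
  shows "(\<Sum>z\<in>Y - {y}. 1 / (z - y)\<^sup>2) \<le> 4 / \<delta>\<^sup>2"
proof -
  \<comment> \<open>The sign \<open>c\<close> reflects the points to the left of \<open>y\<close>,
    so that each side becomes a set of positive points and contributes
    \<open>2 / \<delta>^2\<close>.\<close>
  have *: "(\<Sum>z\<in>Z. 1 / (z - y)\<^sup>2) \<le> 2 / \<delta>\<^sup>2"
    if "Z \<subseteq> Y" "c = 1 \<or> c = -1" "\<And>z. z \<in> Z \<Longrightarrow> 0 < c * (z - y)" for Z and c :: real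
  proof -
    have "(\<Sum>w\<in>(\<lambda>z. c * (z - y)) ` Z. 1 / w\<^sup>2) \<le> 2 / \<delta>\<^sup>2"
    proof (rule sum_inverse_squares_spaced_pos)
      show "finite ((\<lambda>z. c * (z - y)) ` Z)" using assms(1) that(1) finite_subset by blast
      show "\<delta> \<le> w" if w: "w \<in> (\<lambda>z. c * (z - y)) ` Z" for w
      proof -
        obtain z where z: "w = c * (z - y)" "z \<in> Z" using w by auto
        then have "0 < w" "z \<noteq> y" "z \<in> Y"
          using \<open>Z \<subseteq> Y\<close> \<open>\<And>z. z \<in> Z \<Longrightarrow> 0 < c * (z - y)\<close>[of z] by auto
        then have "\<delta> \<le> \<bar>z - y\<bar>" "w = \<bar>w\<bar>" using sp[of z y] assms(3) by auto
        moreover have "\<bar>w\<bar> = \<bar>z - y\<bar>" using z \<open>c = 1 \<or> c = -1\<close> by (auto simp: abs_mult)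
        ultimately show ?thesis by simp
      qed
      show "\<delta> \<le> \<bar>w - v\<bar>"
        if wv: "w \<in> (\<lambda>z. c * (z - y)) ` Z" "v \<in> (\<lambda>z. c * (z - y)) ` Z" "w \<noteq> v" for w v
      proof -
        obtain z x where z: "w = c * (z - y)" "z \<in> Z" "v = c * (x - y)" "x \<in> Z" using wv by auto
        then have "z \<noteq> x" "z \<in> Y" "x \<in> Y" using wv \<open>Z \<subseteq> Y\<close> by auto
        then have "\<delta> \<le> \<bar>z - x\<bar>" by (rule sp[rotated 2])
        moreover have "w - v = c * (z - x)" using z by (simp add: algebra_simps)
        then have "\<bar>w - v\<bar> = \<bar>z - x\<bar>" using \<open>c = 1 \<or> c = -1\<close> by (auto simp: abs_mult)
        ultimately show ?thesis by simp
      qed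
    qed (rule assms(2))
    moreover have "inj_on (\<lambda>z. c * (z - y)) Z" using that(2) by (auto intro: inj_onI)
    ultimately have "(\<Sum>z\<in>Z. 1 / (c * (z - y))\<^sup>2) \<le> 2 / \<delta>\<^sup>2" by (simp add: sum.reindex)
    moreover have "c\<^sup>2 = 1" using that(2) by auto
    ultimately show ?thesis by (simp add: power_mult_distrib)
  qed
  have "Y - {y} = {z\<in>Y. z > y} \<union> {z\<in>Y. z < y}" by auto
  moreover have "(\<Sum>z\<in>{z\<in>Y. z > y} \<union> {z\<in>Y. z < y}. 1 / (z - y)\<^sup>2) =
      (\<Sum>z\<in>{z\<in>Y. z > y}. 1 / (z - y)\<^sup>2) + (\<Sum>z\<in>{z\<in>Y. z < y}. 1 / (z - y)\<^sup>2)"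
    by (rule sum.union_disjoint) (use assms(1) in auto)
  moreover have "(\<Sum>z\<in>{z\<in>Y. z > y}. 1 / (z - y)\<^sup>2) \<le> 2 / \<delta>\<^sup>2"
    by (rule *[of _ 1]) auto
  moreover have "(\<Sum>z\<in>{z\<in>Y. z < y}. 1 / (z - y)\<^sup>2) \<le> 2 / \<delta>\<^sup>2"
    by (rule *[of _ "-1"]) auto
  ultimately have "(\<Sum>z\<in>Y - {y}. 1 / (z - y)\<^sup>2) \<le> 2 / \<delta>\<^sup>2 + 2 / \<delta>\<^sup>2"
    by (simp only: add_mono)
  then show ?thesis by simp
qed

text \<open>The difference is a nonzero integer multiple of \<open>1 / (q * r)\<close>.\<close>

lemma rationals_spaced:
  fixes x y :: real and Q q r :: nat
  assumes "x \<noteq> y" "real q * x \<in> \<int>" "real r * y \<in> \<int>" "1 \<le> q" "q \<le> Q" "1 \<le> r" "r \<le> Q"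
  shows "1 / (real Q)\<^sup>2 \<le> \<bar>x - y\<bar>"
proof -
  have "real q * real r * (x - y) = real r * (real q * x) - real q * (real r * y)"
    by (simp add: algebra_simps)
  also have "\<dots> \<in> \<int>" using assms(2,3) Ints_of_nat by (intro Ints_diff; blast intro: Ints_mult)
  finally have "1 \<le> \<bar>real q * real r * (x - y)\<bar>"
    using assms by (intro Ints_nonzero_abs_ge1) auto
  also have "\<dots> = real q * real r * \<bar>x - y\<bar>" by (simp add: abs_mult)
  also have "\<dots> \<le> real Q * real Q * \<bar>x - y\<bar>" using assms by (intro mult_mono) auto
  finally show ?thesis using assms by (simp add: field_simps power2_eq_square)
qed

text \<open>A row sum of the kernel used in the dual large sieve. The diagonal term
  \<open>s = r\<close> is \<open>K^2\<close>. The other terms are at most \<open>1 / sin^2\<close>,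
  hence at most sums of \<open>1 / (s + k - r)^2\<close> over \<open>k = -1, 0, 1\<close>. Integer
  translation does not change denominators, so the translated points \<open>Y\<close> are still
  \<open>1 / Q^2\<close> apart, and their contribution \<open>4 / \<delta>^2\<close> is
  \<open>4 * Q^4\<close>.\<close>

lemma sum_fejer_le:
  fixes R :: "real set" and Q K :: nat
  assumes R: "finite R" "R \<subseteq> {0..<1}" "\<And>x. x \<in> R \<Longrightarrow> \<exists>q. 1 \<le> q \<and> q \<le> Q \<and> real q * x \<in> \<int>"
    and r: "r \<in> R"
  shows "(\<Sum>s\<in>R. (cmod (\<Sum>i<K. ee (real i * (s - r))))\<^sup>2) \<le> (real K)\<^sup>2 + 4 * (real Q) ^ 4"
proof -
  define I where "I = {-1, 0, 1 :: real}"
  define Y where "Y = (\<lambda>(s, k). s + k) ` (R \<times> I)"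
  define \<delta> where "\<delta> = 1 / (real Q)\<^sup>2"
  have I: "finite I" "I \<subseteq> \<int>" by (auto simp: I_def)
  obtain q where "1 \<le> q" "q \<le> Q" using R(3)[OF r] by auto
  then have Q: "Q \<ge> 1" by simp
  have inj: "inj_on (\<lambda>(s, k). s + k) (R \<times> I)"
  proof (rule inj_onI, clarify)
    fix s k t l assume *: "s \<in> R" "k \<in> I" "t \<in> R" "l \<in> I" "s + k = t + l"
    then have "0 \<le> s" "s < 1" "0 \<le> t" "t < 1" using R(2) by auto
    then show "s = t \<and> k = l" using *(2,4,5) by (auto simp: I_def)
  qed
  have "(cmod (\<Sum>i<K. ee (real i * (s - r))))\<^sup>2 \<le> (\<Sum>k\<in>I. 1 / (s + k - r)\<^sup>2)"
    if s: "s \<in> R - {r}" for s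
  proof -
    have "0 \<le> s" "s < 1" "0 \<le> r" "r < 1" "s \<noteq> r" using R(2) s r by auto
    then have "\<bar>s - r\<bar> < 1" "s - r \<noteq> 0" by auto
    from inverse_sin_squared_le[OF this]
    have 1: "sin (pi * (s - r)) \<noteq> 0"
      "1 / (sin (pi * (s - r)))\<^sup>2 \<le> (\<Sum>k\<in>I. 1 / (s - r + k)\<^sup>2)" unfolding I_def by auto
    have "(cmod (\<Sum>i<K. ee (real i * (s - r))))\<^sup>2 \<le> (\<Sum>k\<in>I. 1 / (s - r + k)\<^sup>2)"
      using norm_geometric_ee_le[OF 1(1), of K] 1(2) by linarith
    then show ?thesis by (simp add: algebra_simps)
  qed
  then have "(\<Sum>s\<in>R - {r}. (cmod (\<Sum>i<K. ee (real i * (s - r))))\<^sup>2)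
      \<le> (\<Sum>s\<in>R - {r}. \<Sum>k\<in>I. 1 / (s + k - r)\<^sup>2)"
    by (rule sum_mono)
  also have "\<dots> = (\<Sum>(s, k)\<in>(R - {r}) \<times> I. 1 / (s + k - r)\<^sup>2)"
    using R(1) I(1) by (subst sum.cartesian_product) auto
  also have "\<dots> = (\<Sum>z\<in>(\<lambda>(s, k). s + k) ` ((R - {r}) \<times> I). 1 / (z - r)\<^sup>2)"
    using inj_on_subset[OF inj, of "(R - {r}) \<times> I"] by (subst sum.reindex) (auto simp: case_prod_unfold)
  also have "\<dots> \<le> (\<Sum>z\<in>Y - {r}. 1 / (z - r)\<^sup>2)"
  proof (rule sum_mono2)
    show "(\<lambda>(s, k). s + k) ` ((R - {r}) \<times> I) \<subseteq> Y - {r}"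
    proof
      fix z assume "z \<in> (\<lambda>(s, k). s + k) ` ((R - {r}) \<times> I)"
      then obtain s k where *: "z = s + k" "s \<in> R" "s \<noteq> r" "k \<in> I" by auto
      have "z \<in> Y" using * unfolding Y_def by force
      moreover have "z \<noteq> r"
      proof
        assume "z = r"
        then have "(s, k) = (r, 0)"
          using * r by (intro inj_onD[OF inj]) (auto simp: I_def)
        then show False using * by simp
      qed
      ultimately show "z \<in> Y - {r}" by simp
    qed
  qed (use R(1) I(1) in \<open>auto simp: Y_def\<close>)
  also have "\<dots> \<le> 4 / \<delta>\<^sup>2"
  proof (rule sum_inverse_squares_spaced)
    show "finite Y" using R(1) I(1) by (simp add: Y_def)
    show "\<delta> > 0" using Q by (simp add: \<delta>_def)
    show "r \<in> Y" using r unfolding Y_def I_def by force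
    have Yq: "\<exists>q. 1 \<le> q \<and> q \<le> Q \<and> real q * y \<in> \<int>" if yY: "y \<in> Y" for y
    proof -
      obtain s k where sk: "s \<in> R" "k \<in> I" "y = s + k" using yY by (auto simp: Y_def)
      obtain q where "1 \<le> q" "q \<le> Q" "real q * s \<in> \<int>" using R(3)[OF sk(1)] by auto
      moreover have "real q * k \<in> \<int>" using I(2) sk(2) by (intro Ints_mult) auto
      ultimately show ?thesis unfolding sk(3) by (metis distrib_left Ints_add)
    qed
    show "\<delta> \<le> \<bar>w - v\<bar>" if "w \<in> Y" "v \<in> Y" "w \<noteq> v" for w v
      using Yq[OF that(1)] Yq[OF that(2)] that(3) unfolding \<delta>_def by (auto intro: rationals_spaced)
  qed
  also have "4 / \<delta>\<^sup>2 = 4 * (real Q) ^ 4" by (simp add: \<delta>_def power_divide flip: power_mult)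
  finally have "(\<Sum>s\<in>R - {r}. (cmod (\<Sum>i<K. ee (real i * (s - r))))\<^sup>2) \<le> 4 * (real Q) ^ 4" .
  then show ?thesis using R(1) r by (subst sum.remove[of R r]) auto
qed

text \<open>The number of ways to write \<open>n \<le> M\<close> as \<open>i - j\<close> with \<open>i, j < 2 * M\<close> is a (scaled)
  Fejer weight that is at least \<open>M\<close>, and its Fourier transform is a squared modulus.\<close>
lemma dual_large_sieve:
  fixes R :: "real set" and Q M :: nat and b :: "real \<Rightarrow> complex"
  assumes R: "finite R" "R \<subseteq> {0..<1}" "\<And>x. x \<in> R \<Longrightarrow> \<exists>q. 1 \<le> q \<and> q \<le> Q \<and> real q * x \<in> \<int>"
    and Q: "Q\<^sup>2 \<le> M"
  shows "(\<Sum>n=1..M. (cmod (\<Sum>r\<in>R. b r * ee (real n * r)))\<^sup>2) \<le> 8 * real M * (\<Sum>r\<in>R. (cmod (b r))\<^sup>2)"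
proof (cases "M = 0")
  case False
  define g where "g = (\<lambda>x::real. (cmod (\<Sum>r\<in>R. b r * ee (x * r)))\<^sup>2)"
  define k where "k = (\<lambda>r s. (cmod (\<Sum>i<2 * M. ee (real i * (s - r))))\<^sup>2)"
  \<comment> \<open>The row sum with \<open>K = 2 * M\<close> is at most
    \<open>4 * M^2 + 4 * Q^4\<close>, and \<open>Q^2 \<le> M\<close>.\<close>
  define B where "B = 8 * (real M)\<^sup>2"
  have k_sym: "k r s = k s r" for r s
  proof -
    have "(\<Sum>i<2 * M. ee (real i * (s - r))) = cnj (\<Sum>i<2 * M. ee (real i * (r - s)))"
      by (simp add: cnj_ee algebra_simps)
    then show ?thesis by (simp only: k_def complex_mod_cnj)
  qed
  have kB: "(\<Sum>s\<in>R. k r s) \<le> B" if "r \<in> R" for r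
  proof -
    have "(\<Sum>s\<in>R. k r s) \<le> (real (2 * M))\<^sup>2 + 4 * (real Q) ^ 4"
      unfolding k_def by (rule sum_fejer_le[OF R that])
    moreover have "(real (Q\<^sup>2))\<^sup>2 \<le> (real M)\<^sup>2" using Q by (intro power_mono) auto
    then have "(real Q) ^ 4 \<le> (real M)\<^sup>2" by (simp flip: power_mult)
    ultimately show ?thesis by (simp add: B_def power_mult_distrib)
  qed
  \<comment> \<open>Writing \<open>n = (n + j) - j\<close> for each \<open>j < M\<close> counts
    every \<open>n\<close> exactly \<open>M\<close> times among the pairs \<open>(i, j)\<close>; the
    other pairs only add nonnegative terms.\<close>
  have "real M * (\<Sum>n=1..M. g (real n)) = (\<Sum>(n, j)\<in>{1..M} \<times> {..<M}. g (real n))"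
    by (simp add: sum_distrib_left flip: sum.cartesian_product)
  also have "\<dots> = (\<Sum>(i, j)\<in>(\<lambda>(n, j). (n + j, j)) ` ({1..M} \<times> {..<M}). g (real i - real j))"
    by (subst sum.reindex) (auto simp: inj_on_def case_prod_unfold)
  also have "\<dots> \<le> (\<Sum>(i, j)\<in>{..<2 * M} \<times> {..<2 * M}. g (real i - real j))"
    by (intro sum_mono2) (auto simp: g_def)
  also have "\<dots> = (\<Sum>i<2 * M. \<Sum>j<2 * M. g (real i - real j))"
    by (simp add: sum.cartesian_product)
  also have "\<dots> = (\<Sum>r\<in>R. \<Sum>s\<in>R. Re (b r * cnj (b s)) * k r s)"
  proof -
    have g: "complex_of_real (g (real i - real j)) =
        (\<Sum>r\<in>R. \<Sum>s\<in>R. b r * cnj (b s) * (ee (real i * (r - s)) * cnj (ee (real j * (r - s)))))" for i j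
    proof -
      have "complex_of_real (g (real i - real j)) =
        (\<Sum>r\<in>R. b r * ee ((real i - real j) * r)) * cnj (\<Sum>r\<in>R. b r * ee ((real i - real j) * r))"
        unfolding g_def by (rule complex_norm_square)
      also have "\<dots> = (\<Sum>r\<in>R. \<Sum>s\<in>R. b r * cnj (b s) *
          (ee ((real i - real j) * r) * cnj (ee ((real i - real j) * s))))"
        by (simp add: sum_product mult_ac)
      also have "\<dots> = (\<Sum>r\<in>R. \<Sum>s\<in>R. b r * cnj (b s) * (ee (real i * (r - s)) * cnj (ee (real j * (r - s)))))"
        by (intro sum.cong refl arg_cong[of _ _ "(*) _"])
           (simp add: cnj_ee algebra_simps flip: ee_add)
      finally show ?thesis .
    qed
    have K: "(\<Sum>i<2 * M. \<Sum>j<2 * M. ee (real i * (r - s)) * cnj (ee (real j * (r - s)))) = of_real (k r s)" for r s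
    proof -
      have "of_real (k s r) = (\<Sum>i<2 * M. ee (real i * (r - s))) * cnj (\<Sum>i<2 * M. ee (real i * (r - s)))"
        unfolding k_def by (rule complex_norm_square)
      then show ?thesis by (simp add: sum_product k_sym[of r s])
    qed
    have "complex_of_real (\<Sum>i<2 * M. \<Sum>j<2 * M. g (real i - real j)) =
      (\<Sum>i<2 * M. \<Sum>j<2 * M. \<Sum>r\<in>R. \<Sum>s\<in>R. b r * cnj (b s) * (ee (real i * (r - s)) * cnj (ee (real j * (r - s)))))"
      by (simp add: g)
    also have "\<dots> = (\<Sum>r\<in>R. \<Sum>i<2 * M. \<Sum>j<2 * M. \<Sum>s\<in>R. b r * cnj (b s) * (ee (real i * (r - s)) * cnj (ee (real j * (r - s)))))"
      by (subst sum.swap[of _ R], subst sum.swap[of _ R]) (rule refl)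
    also have "\<dots> = (\<Sum>r\<in>R. \<Sum>s\<in>R. \<Sum>i<2 * M. \<Sum>j<2 * M. b r * cnj (b s) * (ee (real i * (r - s)) * cnj (ee (real j * (r - s)))))"
      by (intro sum.cong refl) (subst sum.swap[of _ R], subst sum.swap[of _ R], rule refl)
    also have "\<dots> = (\<Sum>r\<in>R. \<Sum>s\<in>R. b r * cnj (b s) * of_real (k r s))"
      by (intro sum.cong refl) (simp only: K[symmetric] sum_distrib_left)
    finally have "Re (complex_of_real (\<Sum>i<2 * M. \<Sum>j<2 * M. g (real i - real j))) =
        Re (\<Sum>r\<in>R. \<Sum>s\<in>R. b r * cnj (b s) * of_real (k r s))" by (rule arg_cong)
    then show ?thesis by simp
  qed
  \<comment> \<open>Schur's test: AM-GM separates \<open>b r\<close> from \<open>b s\<close>, and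
    the symmetry of \<open>k\<close> then leaves only its row sums.\<close>
  also have "\<dots> \<le> (\<Sum>r\<in>R. \<Sum>s\<in>R. ((cmod (b r))\<^sup>2 / 2 + (cmod (b s))\<^sup>2 / 2) * k r s)"
  proof (intro sum_mono mult_right_mono)
    fix r s
    have "Re (b r * cnj (b s)) \<le> cmod (b r * cnj (b s))" by (rule complex_Re_le_cmod)
    also have "\<dots> = cmod (b r) * cmod (b s)" by (simp add: norm_mult)
    also have "\<dots> \<le> (cmod (b r))\<^sup>2 / 2 + (cmod (b s))\<^sup>2 / 2"
      using sum_squares_bound[of "cmod (b r)" "cmod (b s)"] by simp
    finally show "Re (b r * cnj (b s)) \<le> (cmod (b r))\<^sup>2 / 2 + (cmod (b s))\<^sup>2 / 2" .
  qed (simp add: k_def)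
  also have "\<dots> = (\<Sum>r\<in>R. \<Sum>s\<in>R. (cmod (b r))\<^sup>2 / 2 * k r s) + (\<Sum>r\<in>R. \<Sum>s\<in>R. (cmod (b s))\<^sup>2 / 2 * k r s)"
    by (simp add: distrib_right sum.distrib)
  also have "(\<Sum>r\<in>R. \<Sum>s\<in>R. (cmod (b s))\<^sup>2 / 2 * k r s) = (\<Sum>r\<in>R. \<Sum>s\<in>R. (cmod (b r))\<^sup>2 / 2 * k r s)"
    by (subst sum.swap) (simp add: k_sym)
  also have "(\<Sum>r\<in>R. \<Sum>s\<in>R. (cmod (b r))\<^sup>2 / 2 * k r s) + (\<Sum>r\<in>R. \<Sum>s\<in>R. (cmod (b r))\<^sup>2 / 2 * k r s)
      = (\<Sum>r\<in>R. (cmod (b r))\<^sup>2 * (\<Sum>s\<in>R. k r s))"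
    by (simp add: sum_distrib_left sum_distrib_right mult.commute flip: sum.distrib)
  also have "\<dots> \<le> (\<Sum>r\<in>R. (cmod (b r))\<^sup>2 * B)"
    using kB by (intro sum_mono mult_left_mono) auto
  also have "\<dots> = real M * (8 * real M * (\<Sum>r\<in>R. (cmod (b r))\<^sup>2))"
    by (simp add: B_def power2_eq_square mult_ac sum_distrib_left)
  finally have "real M * (\<Sum>n=1..M. g (real n)) \<le> real M * (8 * real M * (\<Sum>r\<in>R. (cmod (b r))\<^sup>2))" .
  then have "(\<Sum>n=1..M. g (real n)) \<le> 8 * real M * (\<Sum>r\<in>R. (cmod (b r))\<^sup>2)"
    using False by (subst (asm) mult_le_cancel_left_pos) auto
  then show ?thesis by (simp add: g_def)
qed simp

text \<open>Duality: the coefficients \<open>b r\<close> are taken to be the conjugates of the very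
  sums to be bounded. With \<open>a\<close> the left-hand side, Cauchy-Schwarz over \<open>S\<close>
  and the dual inequality give \<open>a^2 \<le> 8 * M * a * card S\<close>, from which one factor
  \<open>a\<close> cancels.\<close>

lemma large_sieve:
  fixes R :: "real set" and Q M :: nat and S :: "nat set"
  assumes R: "finite R" "R \<subseteq> {0..<1}" "\<And>x. x \<in> R \<Longrightarrow> \<exists>q. 1 \<le> q \<and> q \<le> Q \<and> real q * x \<in> \<int>"
    and Q: "Q\<^sup>2 \<le> M" and S: "S \<subseteq> {1..M}"
  shows "(\<Sum>r\<in>R. (cmod (\<Sum>n\<in>S. ee (real n * r)))\<^sup>2) \<le> 8 * real M * real (card S)"
proof -
  define b where "b = (\<lambda>r. cnj (\<Sum>n\<in>S. ee (real n * r)))"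
  define g where "g = (\<lambda>n. \<Sum>r\<in>R. b r * ee (real n * r))"
  define a where "a = (\<Sum>r\<in>R. (cmod (b r))\<^sup>2)"
  have "complex_of_real a = (\<Sum>r\<in>R. b r * (\<Sum>n\<in>S. ee (real n * r)))"
    unfolding a_def b_def by (simp add: complex_norm_square mult.commute del: of_real_power cnj_sum)
  also have "\<dots> = (\<Sum>n\<in>S. g n)"
    unfolding g_def by (simp add: sum_distrib_left sum.swap[of _ S])
  finally have "\<bar>a\<bar> = cmod (\<Sum>n\<in>S. g n)" by (metis norm_of_real real_norm_def)
  also have "\<dots> \<le> (\<Sum>n\<in>S. cmod (g n))" by (rule norm_sum)
  finally have "a\<^sup>2 \<le> (\<Sum>n\<in>S. cmod (g n))\<^sup>2"
    by (metis abs_le_square_iff abs_of_nonneg norm_ge_zero sum_nonneg)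
  also have "\<dots> \<le> (\<Sum>n\<in>S. (cmod (g n))\<^sup>2) * card S" by (rule sum_squared_le_sum_of_squares)
  also have "\<dots> \<le> (\<Sum>n=1..M. (cmod (g n))\<^sup>2) * card S"
    using S by (intro mult_right_mono sum_mono2) auto
  also have "\<dots> \<le> 8 * real M * a * card S"
    unfolding a_def g_def by (intro mult_right_mono dual_large_sieve[OF R Q]) auto
  finally have "a * a \<le> a * (8 * real M * real (card S))" by (simp add: power2_eq_square mult_ac)
  moreover have "0 \<le> a" unfolding a_def by (intro sum_nonneg) auto
  ultimately have "a \<le> 8 * real M * real (card S)"
    by (cases "a = 0") (auto simp: mult_le_cancel_left)
  then show ?thesis by (simp only: a_def b_def complex_mod_cnj)
qed

section \<open>Sieving by residue classes\<close>

definition expsum :: "nat set \<Rightarrow> real \<Rightarrow> complex" where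
  "expsum S x = (\<Sum>n\<in>S. ee (real n * x))"

text \<open>Montgomery's local inequality at the modulus \<open>q\<close>. It is required at every
  shift \<open>x\<close>, although the final count evaluates it only at \<open>x = 0\<close>,
  because the passage to a product of moduli applies it at the points
  \<open>b / q + x\<close>.\<close>

definition sieve_gain :: "nat set \<Rightarrow> nat \<Rightarrow> real \<Rightarrow> bool" where
  "sieve_gain S q g \<longleftrightarrow>
     (\<forall>x. g * (cmod (expsum S x))\<^sup>2 \<le> (\<Sum>a\<in>totatives q. (cmod (expsum S (real a / real q + x)))\<^sup>2))"

lemma expsum_add_Ints: "k \<in> \<int> \<Longrightarrow> expsum S (x + k) = expsum S x"
  unfolding expsum_def
  by (intro sum.cong refl) (simp add: distrib_left ee_add ee_Ints)

lemma ee_orthogonality: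
  assumes "r < p" "s < p"
  shows "(\<Sum>a<p. ee (real a * ((real r - real s) / real p))) = (if r = s then of_nat p else 0)"
proof (cases "r = s")
  case False
  define x where "x = (real r - real s) / real p"
  have p: "real p > 0" using assms by simp
  have "\<bar>real r - real s\<bar> < real p" using assms by linarith
  then have "\<bar>x\<bar> < 1" using p by (simp add: x_def)
  moreover have "x \<noteq> 0" using False p by (simp add: x_def)
  ultimately have "sin (pi * x) \<noteq> 0" using inverse_sin_squared_le by blast
  then have ne: "1 - ee x \<noteq> 0" using norm_one_minus_ee[of x] by auto
  have "ee x ^ p = ee (real p * x)" by (rule ee_power[symmetric])
  also have "real p * x = real r - real s" using p by (simp add: x_def)
  also have "ee \<dots> = 1" by (rule ee_Ints) simp
  finally have "(1 - ee x) * (\<Sum>a<p. ee x ^ a) = 0"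
    by (simp add: one_diff_power_eq[symmetric])
  then have "(\<Sum>a<p. ee x ^ a) = 0" using ne by simp
  then show ?thesis using False by (simp add: ee_power flip: x_def)
qed simp

text \<open>As a function of \<open>a\<close>, \<open>expsum S (a / p + x)\<close> is the discrete
  Fourier transform on the integers modulo \<open>p\<close> of the partial sums over residue
  classes, so this is Plancherel's identity there.\<close>

lemma parseval_residues:
  assumes "finite S" "p > 0"
  shows "(\<Sum>a<p. (cmod (expsum S (real a / real p + x)))\<^sup>2) =
    real p * (\<Sum>r<p. (cmod (expsum {n\<in>S. n mod p = r} x))\<^sup>2)"
proof -
  define Z where "Z = (\<lambda>r. expsum {n\<in>S. n mod p = r} x)"
  have E: "expsum S (real a / real p + x) = (\<Sum>r<p. Z r * ee (real a * (real r / real p)))" for a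
  proof -
    have "expsum S (real a / real p + x) = (\<Sum>n\<in>S. ee (real n * x) * ee (real a * (real (n mod p) / real p)))"
      unfolding expsum_def
    proof (intro sum.cong refl)
      fix n
      have "real n = real (p * (n div p) + n mod p)" by simp
      also have "\<dots> = real p * real (n div p) + real (n mod p)" by (simp only: of_nat_add of_nat_mult)
      finally have "real n * (real a / real p) = real a * (real (n mod p) / real p) + real (n div p) * real a"
        using assms(2) by (simp add: field_simps)
      then have "ee (real n * (real a / real p)) = ee (real a * (real (n mod p) / real p))"
        by (simp add: ee_add_Ints)
      then show "ee (real n * (real a / real p + x)) = ee (real n * x) * ee (real a * (real (n mod p) / real p))"
        by (simp add: distrib_left ee_add)
    qed
    also have "\<dots> = (\<Sum>r<p. \<Sum>n\<in>{n\<in>S. n mod p = r}. ee (real n * x) * ee (real a * (real (n mod p) / real p)))"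
      using assms by (intro sum.group[symmetric]) auto
    also have "\<dots> = (\<Sum>r<p. Z r * ee (real a * (real r / real p)))"
      unfolding Z_def expsum_def sum_distrib_right by (intro sum.cong refl) auto
    finally show ?thesis .
  qed
  have "complex_of_real (\<Sum>a<p. (cmod (expsum S (real a / real p + x)))\<^sup>2) =
      (\<Sum>a<p. (\<Sum>r<p. Z r * ee (real a * (real r / real p))) * cnj (\<Sum>r<p. Z r * ee (real a * (real r / real p))))"
    unfolding E of_real_sum complex_norm_square ..
  also have "\<dots> = (\<Sum>a<p. \<Sum>r<p. \<Sum>s<p. Z r * cnj (Z s) * ee (real a * ((real r - real s) / real p)))"
  proof (intro sum.cong refl)
    fix a
    have "ee (real a * (real r / real p)) * cnj (ee (real a * (real s / real p)))
        = ee (real a * ((real r - real s) / real p))" for r s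
      by (simp add: cnj_ee diff_divide_distrib algebra_simps flip: ee_add)
    then show "(\<Sum>r<p. Z r * ee (real a * (real r / real p))) * cnj (\<Sum>r<p. Z r * ee (real a * (real r / real p)))
        = (\<Sum>r<p. \<Sum>s<p. Z r * cnj (Z s) * ee (real a * ((real r - real s) / real p)))"
      by (simp add: sum_product mult_ac)
  qed
  also have "\<dots> = (\<Sum>r<p. \<Sum>s<p. \<Sum>a<p. Z r * cnj (Z s) * ee (real a * ((real r - real s) / real p)))"
    by (rule trans[OF sum.swap], rule sum.cong[OF refl], rule sum.swap)
  also have "\<dots> = (\<Sum>r<p. \<Sum>s<p. if r = s then Z r * cnj (Z s) * of_nat p else 0)"
    by (intro sum.cong refl, subst sum_distrib_left[symmetric], subst ee_orthogonality) auto
  also have "\<dots> = (\<Sum>r<p. complex_of_real (real p * (cmod (Z r))\<^sup>2))"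
    by (simp add: complex_norm_square mult.commute del: of_real_power)
  also have "\<dots> = complex_of_real (real p * (\<Sum>r<p. (cmod (Z r))\<^sup>2))"
    by (simp add: sum_distrib_left)
  finally show ?thesis unfolding Z_def by (simp only: of_real_eq_iff)
qed

text \<open>\<open>expsum S x\<close> is a sum of at most \<open>\<mu> * p\<close> class sums.
  Cauchy-Schwarz and Parseval bound its square by \<open>\<mu>\<close> times the sum over all
  \<open>a < p\<close>; moving the term \<open>a = 0\<close> to the left leaves
  \<open>1 - \<mu>\<close>. The remaining factor \<open>\<mu>\<close> on the right is estimated by
  \<open>1\<close>.\<close>

lemma sieve_gain_prime:
  assumes "finite S" "prime p" "0 < \<mu>" "real (card ((\<lambda>n. n mod p) ` S)) \<le> \<mu> * real p"
    and "\<mu> \<le> 1"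
  shows "sieve_gain S p (1 - \<mu>)"
  unfolding sieve_gain_def
proof
  fix x
  define Z where "Z = (\<lambda>r. expsum {n\<in>S. n mod p = r} x)"
  have p: "p > 0" using assms(2) by (rule prime_gt_0_nat)
  have "expsum S x = (\<Sum>r\<in>(\<lambda>n. n mod p) ` S. Z r)"
    unfolding Z_def expsum_def using assms(1) by (intro sum.group[symmetric]) auto
  then have "cmod (expsum S x) \<le> (\<Sum>r\<in>(\<lambda>n. n mod p) ` S. cmod (Z r))"
    by (simp add: norm_sum)
  then have "(cmod (expsum S x))\<^sup>2 \<le> (\<Sum>r\<in>(\<lambda>n. n mod p) ` S. cmod (Z r))\<^sup>2"
    by (intro power_mono) auto
  also have "\<dots> \<le> (\<Sum>r\<in>(\<lambda>n. n mod p) ` S. (cmod (Z r))\<^sup>2) * real (card ((\<lambda>n. n mod p) ` S))"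
    by (rule sum_squared_le_sum_of_squares)
  also have "\<dots> \<le> (\<Sum>r<p. (cmod (Z r))\<^sup>2) * (\<mu> * real p)"
    using p by (intro mult_mono[OF _ assms(4)] sum_mono2 sum_nonneg) auto
  also have "\<dots> = \<mu> * (\<Sum>a<p. (cmod (expsum S (real a / real p + x)))\<^sup>2)"
    unfolding parseval_residues[OF assms(1) p] Z_def by simp
  also have "{..<p} = insert 0 (totatives p)"
    using p totatives_prime[OF assms(2)] by auto
  also have "(\<Sum>a\<in>insert 0 (totatives p). (cmod (expsum S (real a / real p + x)))\<^sup>2) =
     (cmod (expsum S x))\<^sup>2 + (\<Sum>a\<in>totatives p. (cmod (expsum S (real a / real p + x)))\<^sup>2)"
    by (subst sum.insert) auto
  finally have "(1 - \<mu>) * (cmod (expsum S x))\<^sup>2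
      \<le> \<mu> * (\<Sum>a\<in>totatives p. (cmod (expsum S (real a / real p + x)))\<^sup>2)"
    by (simp add: algebra_simps)
  also have "\<dots> \<le> 1 * (\<Sum>a\<in>totatives p. (cmod (expsum S (real a / real p + x)))\<^sup>2)"
    using assms(5) by (intro mult_right_mono sum_nonneg) auto
  finally show "(1 - \<mu>) * (cmod (expsum S x))\<^sup>2
      \<le> (\<Sum>a\<in>totatives p. (cmod (expsum S (real a / real p + x)))\<^sup>2)"
    by simp
qed

text \<open>By the Chinese remainder theorem the sums \<open>a / p + b / q\<close> are, modulo
  integers, distinct fractions \<open>c / (p * q)\<close> with \<open>c\<close> coprime to
  \<open>p * q\<close>. The gain at \<open>q\<close> is applied at \<open>x\<close>, then the gain
  at \<open>p\<close> at each \<open>b / q + x\<close>; the periodicity of \<open>expsum\<close>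
  disposes of the integer parts.\<close>

lemma sieve_gain_mult:
  assumes cop: "coprime p q" and pq: "p > 1" "q > 1" and "0 \<le> g"
    and "sieve_gain S p g" "sieve_gain S q h"
  shows "sieve_gain S (p * q) (g * h)"
  unfolding sieve_gain_def
proof
  fix x
  define G where "G = (\<lambda>y. (cmod (expsum S y))\<^sup>2)"
  define \<phi> where "\<phi> = (\<lambda>(a, b). (a * q + b * p) mod (p * q))"
  have \<phi>_tot: "\<phi> (a, b) \<in> totatives (p * q)" if "a \<in> totatives p" "b \<in> totatives q" for a b
  proof -
    have ab: "coprime a p" "coprime b q" using that by (auto simp: in_totatives_iff)
    have "coprime (a * q + b * p) p"
      using ab cop by (metis coprime_commute coprime_mult_left_iff gcd_add_mult coprime_iff_gcd_eq_1 gcd.commute add.commute)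
    moreover have "coprime (a * q + b * p) q"
      using ab cop by (metis coprime_commute coprime_mult_left_iff gcd_add_mult coprime_iff_gcd_eq_1 gcd.commute add.commute)
    ultimately have "coprime (a * q + b * p) (p * q)" by simp
    then have c: "coprime (\<phi> (a, b)) (p * q)"
      unfolding \<phi>_def prod.case by (rule coprime_mod_left_iff[THEN iffD2, rotated]) (use pq in simp)
    have "\<phi> (a, b) \<noteq> 0"
    proof
      assume "\<phi> (a, b) = 0"
      then have "p * q = 1" using c by simp
      then show False using pq by simp
    qed
    moreover have "\<phi> (a, b) < p * q" unfolding \<phi>_def using pq by simp
    ultimately show ?thesis using c by (simp add: in_totatives_iff)
  qed
  have inj: "inj_on \<phi> (totatives p \<times> totatives q)"
  proof (rule inj_onI, clarify)
    fix a b c d assume *: "a \<in> totatives p" "b \<in> totatives q" "c \<in> totatives p" "d \<in> totatives q"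
      and "\<phi> (a, b) = \<phi> (c, d)"
    then have eq: "[a * q + b * p = c * q + d * p] (mod p * q)" by (simp add: \<phi>_def cong_def)
    have lt: "a < p" "c < p" "b < q" "d < q" using * pq totatives_less by auto
    have "[a * q + b * p = c * q + d * p] (mod p)" using eq by (rule cong_modulus_mult_nat)
    then have "[a * q = c * q] (mod p)" by (simp add: cong_def)
    then have "[a = c] (mod p)" using cop by (simp add: cong_mult_rcancel_nat coprime_commute)
    then have "a = c" using lt by (simp add: cong_def)
    have "[a * q + b * p = c * q + d * p] (mod q)"
      using eq by (metis cong_modulus_mult_nat mult.commute)
    then have "[b * p = d * p] (mod q)" by (simp add: cong_def)
    then have "[b = d] (mod q)" using cop by (simp add: cong_mult_rcancel_nat coprime_commute)
    then have "b = d" using lt by (simp add: cong_def)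
    show "a = c \<and> b = d" using \<open>a = c\<close> \<open>b = d\<close> by simp
  qed
  have G\<phi>: "G (real (\<phi> (a, b)) / real (p * q) + x) = G (real a / real p + (real b / real q + x))" for a b
  proof -
    define m where "m = (a * q + b * p) div (p * q)"
    have "a * q + b * p = m * (p * q) + \<phi> (a, b)" unfolding \<phi>_def m_def prod.case by (rule div_mult_mod_eq[symmetric])
    then have "real a * real q + real b * real p = real m * (real p * real q) + real (\<phi> (a, b))"
      by (metis of_nat_add of_nat_mult)
    then have "real a / real p + (real b / real q + x) = (real (\<phi> (a, b)) / real (p * q) + x) + real m"
      using pq by (simp add: field_simps)
    then show ?thesis unfolding G_def by (simp only: expsum_add_Ints[OF Ints_of_nat])
  qed
  have "g * h * G x \<le> g * (\<Sum>b\<in>totatives q. G (real b / real q + x))"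
    using assms(4,6) unfolding sieve_gain_def G_def mult.assoc by (intro mult_left_mono) auto
  also have "\<dots> \<le> (\<Sum>b\<in>totatives q. \<Sum>a\<in>totatives p. G (real a / real p + (real b / real q + x)))"
    using assms(5) unfolding sum_distrib_left sieve_gain_def G_def by (intro sum_mono) auto
  also have "\<dots> = (\<Sum>(a, b)\<in>totatives p \<times> totatives q. G (real (\<phi> (a, b)) / real (p * q) + x))"
    by (simp only: G\<phi>) (subst sum.swap, simp add: sum.cartesian_product)
  also have "\<dots> = (\<Sum>c\<in>\<phi> ` (totatives p \<times> totatives q). G (real c / real (p * q) + x))"
    using inj by (simp add: sum.reindex case_prod_unfold)
  also have "\<dots> \<le> (\<Sum>c\<in>totatives (p * q). G (real c / real (p * q) + x))"
    using \<phi>_tot by (intro sum_mono2) (auto simp: G_def)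
  finally show "g * h * (cmod (expsum S x))\<^sup>2 \<le>
      (\<Sum>a\<in>totatives (p * q). (cmod (expsum S (real a / real (p * q) + x)))\<^sup>2)"
    unfolding G_def .
qed

text \<open>At \<open>x = 0\<close> the exponential sum equals \<open>card S\<close>, so each
  modulus contributes \<open>g q * (card S)^2\<close>. Fractions in lowest terms with different
  moduli never coincide, so all of them together form one point set \<open>R\<close> for the large
  sieve; one factor \<open>card S\<close> then cancels.\<close>

lemma sieve_bound:
  assumes S: "S \<subseteq> {1..M}" and QM: "Q\<^sup>2 \<le> M" and fin: "finite \<Q>"
    and \<Q>: "\<And>q. q \<in> \<Q> \<Longrightarrow> 1 < q \<and> q \<le> Q"
    and gain: "\<And>q. q \<in> \<Q> \<Longrightarrow> sieve_gain S q (g q)"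
  shows "real (card S) * (\<Sum>q\<in>\<Q>. g q) \<le> 8 * real M"
proof (cases "S = {}")
  case False
  define G where "G = (\<lambda>y. (cmod (expsum S y))\<^sup>2)"
  define \<psi> where "\<psi> = (\<lambda>(q, a). real a / real (q::nat))"
  define R where "R = \<psi> ` (SIGMA q:\<Q>. totatives q)"
  have inj: "inj_on \<psi> (SIGMA q:\<Q>. totatives q)"
  proof (rule inj_onI, clarify)
    fix q a r b assume *: "q \<in> \<Q>" "a \<in> totatives q" "r \<in> \<Q>" "b \<in> totatives r" "\<psi> (q, a) = \<psi> (r, b)"
    then have "real a * real r = real b * real q"
      using \<Q>[of q] \<Q>[of r] by (auto simp: \<psi>_def field_simps)
    then have "a * r = b * q" by (metis of_nat_eq_iff of_nat_mult)
    moreover have "coprime a q" "coprime b r" using * by (auto simp: in_totatives_iff)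
    ultimately have "a = b \<and> r = q"
      using coprime_crossproduct_nat[of a q b r] by (simp add: coprime_commute mult.commute)
    then show "q = r \<and> a = b" by simp
  qed
  have "(\<Sum>q\<in>\<Q>. g q) * (real (card S))\<^sup>2 = (\<Sum>q\<in>\<Q>. g q * G 0)"
    by (simp add: G_def expsum_def sum_distrib_right)
  also have "\<dots> \<le> (\<Sum>q\<in>\<Q>. \<Sum>a\<in>totatives q. G (real a / real q))"
  proof (rule sum_mono)
    fix q assume "q \<in> \<Q>"
    then show "g q * G 0 \<le> (\<Sum>a\<in>totatives q. G (real a / real q))"
      using gain[unfolded sieve_gain_def, THEN spec, of q 0] by (simp add: G_def)
  qed
  also have "\<dots> = (\<Sum>x\<in>R. G x)"
    unfolding R_def using inj fin by (simp add: sum.reindex sum.Sigma case_prod_unfold \<psi>_def)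
  also have "\<dots> \<le> 8 * real M * real (card S)"
    unfolding G_def expsum_def
  proof (rule large_sieve[OF _ _ _ QM S])
    show "finite R" unfolding R_def using fin by auto
    have *: "0 \<le> \<psi> (q, a) \<and> \<psi> (q, a) < 1" if "q \<in> \<Q>" "a \<in> totatives q" for q a
      using \<Q>[OF that(1)] totatives_less[OF that(2)] by (simp add: \<psi>_def)
    then show "R \<subseteq> {0..<1}" by (auto simp: R_def)
    fix x assume "x \<in> R"
    then obtain q a where "q \<in> \<Q>" "x = real a / real q" by (auto simp: R_def \<psi>_def)
    then show "\<exists>q. 1 \<le> q \<and> q \<le> Q \<and> real q * x \<in> \<int>"
      using \<Q>[of q] by (intro exI[of _ q]) auto
  qed
  finally have "real (card S) * (real (card S) * (\<Sum>q\<in>\<Q>. g q)) \<le> real (card S) * (8 * real M)"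
    by (simp add: power2_eq_square mult_ac)
  moreover have "0 < real (card S)" using False S finite_subset[of S "{1..M}"] by (simp add: card_gt_0_iff)
  ultimately show ?thesis by (subst (asm) mult_le_cancel_left_pos)
qed simp

lemma sieve_bound_primes:
  assumes "S \<subseteq> {1..M}" "Q\<^sup>2 \<le> M" "finite P" "0 < \<mu>" "\<mu> \<le> 1"
    and P: "\<And>p. p \<in> P \<Longrightarrow> prime p \<and> p \<le> Q \<and> real (card ((\<lambda>n. n mod p) ` S)) \<le> \<mu> * real p"
  shows "real (card S) * ((1 - \<mu>) * real (card P)) \<le> 8 * real M"
proof -
  have "finite S" using assms(1) finite_subset by blast
  have "real (card S) * (\<Sum>p\<in>P. 1 - \<mu>) \<le> 8 * real M"
    using P sieve_gain_prime[OF \<open>finite S\<close> _ assms(4) _ assms(5)]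
    by (intro sieve_bound[OF assms(1-3)]) (auto simp: prime_gt_Suc_0_nat)
  then show ?thesis by (simp add: mult.commute)
qed

lemma prime_mult_eq_prime_mult:
  fixes p q r s :: nat
  assumes "prime p" "prime q" "prime r" "prime s" "p < q" "r < s" "p * q = r * s"
  shows "p = r \<and> q = s"
proof -
  have "p dvd r * s" "r dvd p * q" using assms(7) by (metis dvd_triv_left)+
  then have "p dvd r \<or> p dvd s" "r dvd p \<or> r dvd q"
    using assms(1,3) by (simp_all add: prime_dvd_mult_iff)
  then have "p = r \<or> p = s" "r = p \<or> r = q"
    using assms(1-4) primes_dvd_imp_eq by blast+
  then have "p = r" using assms(5,6) by auto
  then show ?thesis using assms by (simp add: prime_gt_0_nat)
qed

text \<open>The condition \<open>p < q\<close> lets the product determine the pair, so distinct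
  pairs are distinct moduli, each with gain \<open>(1 - \<mu>)^2\<close>.\<close>

lemma sieve_bound_prime_pairs:
  assumes "S \<subseteq> {1..M}" "Q\<^sup>2 \<le> M" "finite W" "0 < \<mu>" "\<mu> \<le> 1"
    and W: "\<And>p q. (p, q) \<in> W \<Longrightarrow> p < q \<and> p * q \<le> Q"
    and P: "\<And>p. p \<in> fst ` W \<union> snd ` W \<Longrightarrow> prime p \<and> real (card ((\<lambda>n. n mod p) ` S)) \<le> \<mu> * real p"
  shows "real (card S) * ((1 - \<mu>)\<^sup>2 * real (card W)) \<le> 8 * real M"
proof -
  have "finite S" using assms(1) finite_subset by blast
  have gain: "sieve_gain S p (1 - \<mu>)" if "p \<in> fst ` W \<union> snd ` W" for p
    using P[OF that] sieve_gain_prime[OF \<open>finite S\<close> _ assms(4) _ assms(5)] by blast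
  have mem: "p \<in> fst ` W \<union> snd ` W" "q \<in> fst ` W \<union> snd ` W" if "(p, q) \<in> W" for p q
    using image_eqI[of p fst "(p, q)"] image_eqI[of q snd "(p, q)"] that by simp_all
  have pr: "prime p" "prime q" if "(p, q) \<in> W" for p q
    using P[OF mem(1)[OF that]] P[OF mem(2)[OF that]] by simp_all
  have inj: "inj_on (\<lambda>(p, q). p * q) W"
  proof (rule inj_onI, clarify)
    fix p q r s assume "(p, q) \<in> W" "(r, s) \<in> W" "p * q = r * s"
    then show "p = r \<and> q = s"
      using prime_mult_eq_prime_mult[of p q r s] pr W by blast
  qed
  have "real (card S) * (\<Sum>m\<in>(\<lambda>(p, q). p * q) ` W. (1 - \<mu>) * (1 - \<mu>)) \<le> 8 * real M"
  proof (rule sieve_bound[OF assms(1,2)])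
    show "finite ((\<lambda>(p, q). p * q) ` W)" using assms(3) by simp
    fix m assume "m \<in> (\<lambda>(p, q). p * q) ` W"
    then obtain p q where m: "m = p * q" "(p, q) \<in> W" by auto
    have "1 < p" "1 < q" using pr[OF m(2)] prime_gt_1_nat by auto
    then show "1 < m \<and> m \<le> Q" using W[OF m(2)] m(1) less_1_mult[of p q] by simp
    have "coprime p q" using pr[OF m(2)] W[OF m(2)] by (intro primes_coprime) auto
    then show "sieve_gain S m ((1 - \<mu>) * (1 - \<mu>))"
      unfolding m(1) using \<open>1 < p\<close> \<open>1 < q\<close> gain mem[OF m(2)] assms(5)
      by (intro sieve_gain_mult) simp_all
  qed
  then show ?thesis using inj by (simp add: card_image power2_eq_square mult_ac)
qed

section \<open>A lower bound for the number of primes\<close>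

text \<open>The recurrence of the Leibniz harmonic triangle, whose entries are
  \<open>1 / ((n + 1) * (n choose m))\<close>: an entry is the difference of two entries with the
  smaller column index \<open>m\<close>.\<close>

lemma leibniz_triangle:
  assumes "m \<le> n"
  shows "1 / (real (n + 2) * real (Suc n choose Suc m)) =
         1 / (real (n + 1) * real (n choose m)) - 1 / (real (n + 2) * real (Suc n choose m))"
proof -
  have "Suc m * (Suc n choose Suc m) = Suc n * (n choose m)"
    by (rule Suc_times_binomial)
  then have 1: "real (Suc n choose Suc m) = real (n + 1) * real (n choose m) / real (m + 1)"
    by (simp add: field_simps flip: of_nat_mult of_nat_Suc)
  have "(Suc n - m) * (Suc n choose m) = Suc n * (n choose m)"
    using binomial_absorb_comp[of "Suc n" m] by simp
  then have "real (Suc n - m) * real (Suc n choose m) = real (Suc n) * real (n choose m)"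
    by (metis of_nat_mult)
  then have 2: "real (Suc n choose m) = real (n + 1) * real (n choose m) / (real n + 1 - real m)"
    using assms by (simp add: field_simps of_nat_diff)
  have *: "s / (x * (y * b)) = 1 / (y * b) - t / (x * (y * b))"
    if "x \<noteq> 0" "y \<noteq> 0" "b \<noteq> 0" "x = s + t" for x y b s t :: real
    using that by (simp add: divide_simps)
  have "real (n choose m) > 0" using assms by simp
  then show ?thesis
    using assms *[of "real (n + 2)" "real (n + 1)" "real (n choose m)" "real (m + 1)" "real n + 1 - real m"]
    unfolding 1 2 by simp
qed

text \<open>By the recurrence, every entry of row \<open>n\<close> of the harmonic triangle is an
  integer combination of \<open>1 / 1, ..., 1 / (n + 1)\<close>, so \<open>Lcm {1..n + 1}\<close>
  clears its denominator. The induction runs over the column \<open>m\<close>, starting from the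
  entries \<open>1 / (n + 1)\<close>.\<close>

lemma dvd_Lcm_atLeastAtMost:
  assumes "m \<le> n"
  shows "(n + 1) * (n choose m) dvd Lcm {1..n + 1}"
proof -
  have *: "real (Lcm {1..n + 1}) / (real (n + 1) * real (n choose m)) \<in> \<int>"
    using assms
  proof (induction m arbitrary: n)
    case 0
    have "n + 1 dvd Lcm {1..n + 1}" by (rule dvd_Lcm) auto
    then obtain c where "Lcm {1..n + 1} = (n + 1) * c" by (elim dvdE)
    then have "real (Lcm {1..n + 1}) / (real (n + 1) * real (n choose 0)) = real c"
      by (simp only: of_nat_mult binomial_n_0) simp
    then show ?case by simp
  next
    case (Suc m)
    then obtain k where n: "n = Suc k" "m \<le> k" by (cases n) auto
    have "Lcm {1..k + 1} dvd Lcm {1..n + 1}" by (rule Lcm_subset) (use n in auto)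
    then obtain c where c: "Lcm {1..n + 1} = Lcm {1..k + 1} * c" by (elim dvdE)
    have "real (Lcm {1..n + 1}) / (real (n + 1) * real (n choose Suc m)) =
       real c * (real (Lcm {1..k + 1}) / (real (k + 1) * real (k choose m)))
       - real (Lcm {1..n + 1}) / (real (n + 1) * real (n choose m))"
      using arg_cong[OF leibniz_triangle[OF n(2)], of "\<lambda>x. real (Lcm {1..n + 1}) * x"]
      unfolding n(1) c[unfolded n(1)]
      by (simp add: algebra_simps del: of_nat_Suc of_nat_add binomial_Suc_Suc)
    also have "\<dots> \<in> \<int>"
      using Suc.IH[OF n(2)] Suc.IH[of n] n by (intro Ints_diff Ints_mult) auto
    finally show ?case .
  qed
  define a where "a = (n + 1) * (n choose m)"
  have "a > 0" using assms by (simp add: a_def)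
  have "real (Lcm {1..n + 1}) / real a \<in> \<int>"
    using * by (simp only: a_def of_nat_mult)
  then obtain z :: int where "real (Lcm {1..n + 1}) / real a = of_int z" by (elim Ints_cases)
  then have "real (Lcm {1..n + 1}) = of_int z * real a" using \<open>a > 0\<close> by (simp add: field_simps)
  then have "int (Lcm {1..n + 1}) = z * int a"
    by (metis (mono_tags, opaque_lifting) of_int_eq_iff of_int_mult of_int_of_nat_eq)
  then have "int a dvd int (Lcm {1..n + 1})" by simp
  then show ?thesis unfolding a_def by (simp only: int_dvd_int_iff)
qed

lemma prime_power_dvd_Lcm_imp:
  fixes p :: nat
  assumes "finite A" "prime p" "p ^ k dvd Lcm A" "k > 0"
  shows "\<exists>a\<in>A. p ^ k dvd a"
  using assms(1,3)
proof (induction A)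
  case empty
  then show ?case using assms by auto
next
  case (insert x A)
  have "p ^ k dvd x \<or> p ^ k dvd Lcm A"
  proof (cases "x = 0 \<or> Lcm A = 0")
    case False
    have "k \<le> multiplicity p (lcm x (Lcm A))"
      using insert False assms by (intro multiplicity_geI) auto
    also have "\<dots> = max (multiplicity p x) (multiplicity p (Lcm A))"
      using False assms by (intro multiplicity_lcm) auto
    finally show ?thesis by (auto simp: multiplicity_dvd' le_max_iff_disj)
  qed auto
  then show ?case using insert by auto
qed

text \<open>Every full prime power in the least common multiple already divides one of
  \<open>1, ..., n\<close> and is therefore at most \<open>n\<close>; there is at most one such
  factor for each prime up to \<open>n\<close>.\<close>

lemma Lcm_atLeastAtMost_le: "Lcm {1..n::nat} \<le> n ^ card {p. prime p \<and> p \<le> n}"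
proof -
  define L where "L = Lcm {1..n}"
  have L0: "L \<noteq> 0" unfolding L_def by (simp add: Lcm_0_iff_nat)
  have mult: "p \<le> n \<and> p ^ multiplicity p L \<le> n" if "p \<in> prime_factors L" for p
  proof -
    have p: "prime p" "p dvd L" using that by (auto simp: in_prime_factors_iff)
    then have k: "multiplicity p L > 0" using L0 by (simp add: prime_multiplicity_gt_zero_iff)
    have "p ^ multiplicity p L dvd L" by (rule multiplicity_dvd)
    then obtain a where a: "a \<in> {1..n}" "p ^ multiplicity p L dvd a"
      using prime_power_dvd_Lcm_imp[of "{1..n}" p "multiplicity p L"] p k by (auto simp: L_def)
    have "p ^ multiplicity p L \<le> n" using a dvd_imp_le[OF a(2)] by auto
    moreover have "p \<le> p ^ multiplicity p L" 
      using k prime_gt_0_nat[OF p(1)] by (intro self_le_power) auto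
    ultimately show ?thesis by auto
  qed
  show ?thesis
  proof (cases "n = 0")
    case False
    have "L = (\<Prod>p\<in>prime_factors L. p ^ multiplicity p L)"
      using L0 prod_prime_factors[of L] by simp
    also have "\<dots> \<le> (\<Prod>p\<in>prime_factors L. n)"
      using mult by (intro prod_mono) auto
    also have "\<dots> = n ^ card (prime_factors L)" by simp
    also have "\<dots> \<le> n ^ card {p. prime p \<and> p \<le> n}"
      using False mult by (intro power_increasing card_mono) auto
    finally show ?thesis unfolding L_def .
  next
    case True
    then have "{p. prime p \<and> p \<le> n} = {}" by auto
    then have c: "card {p. prime p \<and> p \<le> n} = 0" by (simp only: card.empty)
    show ?thesis unfolding c using True by simp
  qed
qed

text \<open>Nair's argument with the middle entry of an even row:
  \<open>4^k \<le> (2 * k + 1) * (2 * k choose k)\<close>, which divides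
  \<open>Lcm {1..2 * k + 1}\<close>, and this is at most \<open>n\<close> to the number of primes up
  to \<open>n\<close>. Taking logarithms gives the claim.\<close>

lemma chebyshev_lower:
  assumes "n \<ge> 2"
  shows "real n / (6 * ln (real n)) \<le> real (card {p::nat. prime p \<and> p \<le> n})"
proof (cases "n = 2")
  case True
  have "card {2::nat} \<le> card {p::nat. prime p \<and> p \<le> 2}" by (intro card_mono) auto
  then have "1 \<le> real (card {p::nat. prime p \<and> p \<le> 2})" by simp
  moreover have "real 2 / (6 * ln (real 2)) \<le> 1" using ln2_ge_two_thirds by (simp add: field_simps)
  ultimately show ?thesis unfolding True by linarith
next
  case False
  \<comment> \<open>The largest \<open>k\<close> with \<open>2 * k + 1 \<le> n\<close>. For
    \<open>n = 2\<close> it would be \<open>0\<close>, which is why that case is separate; otherwise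
    \<open>n \<le> 2 * k + 2 \<le> 4 * k\<close>, and \<open>ln 4 \<ge> 4 / 3\<close> leaves room
    for the constant \<open>6\<close>.\<close>
  define k where "k = (n - 1) div 2"
  have k: "k > 0" "2 * k + 1 \<le> n" "n \<le> 2 * k + 2" using False assms by (auto simp: k_def)
  have lnp: "ln (real n) > 0" using assms by simp
  have "4 ^ k \<le> real (2 * k + 1) * real (2 * k choose k)"
  proof -
    have "4 ^ k / (2 * real k) \<le> real (2 * k choose k)"
      using central_binomial_lower_bound[OF k(1)] by simp
    then have "4 ^ k \<le> (2 * real k) * real (2 * k choose k)" using k by (simp add: field_simps)
    also have "\<dots> \<le> real (2 * k + 1) * real (2 * k choose k)" by (intro mult_right_mono) auto
    finally show ?thesis .
  qed
  also have "\<dots> = real ((2 * k + 1) * (2 * k choose k))" by (rule of_nat_mult[symmetric])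
  also have "\<dots> \<le> real (Lcm {1..2 * k + 1})"
    using dvd_Lcm_atLeastAtMost[of k "2 * k"] 
    by (intro of_nat_mono dvd_imp_le) (auto simp: Lcm_0_iff_nat intro!: Nat.gr0I)
  also have "\<dots> \<le> real (Lcm {1..n})"
    using k by (intro of_nat_mono dvd_imp_le Lcm_subset) (auto simp: Lcm_0_iff_nat intro!: Nat.gr0I)
  also have "\<dots> \<le> real (n ^ card {p. prime p \<and> p \<le> n})"
    using Lcm_atLeastAtMost_le by (intro of_nat_mono)
  finally have "ln (4 ^ k) \<le> ln (real n ^ card {p. prime p \<and> p \<le> n})"
    using assms by (subst ln_le_cancel_iff) auto
  then have *: "real k * ln 4 \<le> real (card {p. prime p \<and> p \<le> n}) * ln (real n)"
    using assms by (simp add: ln_realpow)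
  have "ln (4::real) = 2 * ln 2" using ln_realpow[of "2::real" 2] by simp
  then have "real k * ln 4 \<ge> real k * (4 / 3)" using ln2_ge_two_thirds by (intro mult_left_mono) auto
  moreover have "real k * (4 / 3) \<ge> real n / 6" using k False assms by linarith
  ultimately have "real n / 6 \<le> real (card {p. prime p \<and> p \<le> n}) * ln (real n)" using * by linarith
  then show ?thesis using lnp by (simp add: field_simps)
qed

section \<open>Dense sets of primes\<close>

lemma eta_dense_count:
  assumes "eta_dense \<eta> P" "0 < \<eta>"
  shows "\<forall>\<^sub>F n in sequentially. \<eta> / 6 * real n / ln (real n) \<le> real (card {p\<in>P. p \<le> n})"
proof -
  have "\<forall>\<^sub>F n in sequentially. real (card {p\<in>P. real p \<le> real n}) / real (prime_pi (real n)) > \<eta>"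
    using assms(1) filterlim_real_sequentially unfolding eta_dense_def filterlim_iff by blast
  then show ?thesis using eventually_ge_at_top[of 2]
  proof eventually_elim
    case (elim n)
    have pi: "prime_pi (real n) = card {p. prime p \<and> p \<le> n}" by (simp add: prime_pi_def)
    have "0 < real n / (6 * ln (real n))" using elim(2) by simp
    also note ch = chebyshev_lower[OF elim(2)]
    finally have pos: "0 < real (prime_pi (real n))" unfolding pi .
    have "\<eta> / 6 * real n / ln (real n) = \<eta> * (real n / (6 * ln (real n)))" by simp
    also have "\<dots> \<le> \<eta> * real (prime_pi (real n))"
      unfolding pi using assms(2) ch by (intro mult_left_mono) auto
    also have "\<dots> \<le> real (card {p\<in>P. p \<le> n})"
      using elim(1) pos by (simp add: field_simps)
    finally show ?case .
  qed
qed

text \<open>A number with \<open>w\<close> prime divisors is at least \<open>2^w\<close>, and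
  \<open>1 / ln 2 \<le> 2\<close>.\<close>

lemma card_prime_divisors_le:
  assumes "D > (0::nat)"
  shows "real (card {p. prime p \<and> p dvd D}) \<le> 2 * ln (real D)"
proof -
  have fin: "finite {p. prime p \<and> p dvd D}" using assms by (auto intro: finite_subset[OF _ finite_divisors_nat])
  have eq: "{p. prime p \<and> p dvd D} = prime_factors D" using assms by (auto simp: in_prime_factors_iff)
  have "2 ^ card (prime_factors D) = (\<Prod>p\<in>prime_factors D. 2::nat)" by simp
  also have "\<dots> \<le> (\<Prod>p\<in>prime_factors D. p ^ multiplicity p D)"
  proof (intro prod_mono conjI)
    fix p assume p: "p \<in> prime_factors D"
    then have "2 \<le> p" by (auto simp: in_prime_factors_iff prime_ge_2_nat)
    moreover have "multiplicity p D > 0"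
      using p assms by (auto simp: in_prime_factors_iff prime_multiplicity_gt_zero_iff)
    then have "p \<le> p ^ multiplicity p D" using \<open>2 \<le> p\<close> by (intro self_le_power) auto
    ultimately show "2 \<le> p ^ multiplicity p D" by linarith
  qed auto
  also have "\<dots> = D" using assms prod_prime_factors[of D] by simp
  finally have "real (2 ^ card (prime_factors D)) \<le> real D" by (rule of_nat_mono)
  then have "ln (2 ^ card (prime_factors D)) \<le> ln (real D)"
    using assms by (subst ln_le_cancel_iff) auto
  then have "real (card (prime_factors D)) * ln 2 \<le> ln (real D)" by (simp add: ln_realpow)
  moreover have "real (card (prime_factors D)) * (1 / 2) \<le> real (card (prime_factors D)) * ln 2"
    using ln2_ge_two_thirds by (intro mult_left_mono) auto
  ultimately show ?thesis unfolding eq by linarith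
qed

text \<open>Two uses of \<open>ln (1 + t) \<le> t\<close>, first for the inner and then for the
  outer logarithm. Summed over \<open>n\<close>, this replaces the integral of
  \<open>1 / (x * ln x)\<close>.\<close>

lemma ln_ln_Suc_diff_le:
  assumes "n \<ge> 2"
  shows "ln (ln (real (Suc n))) - ln (ln (real n)) \<le> 1 / (real n * ln (real n))"
proof -
  have n: "real n > 0" "ln (real n) > 0" using assms by auto
  have "real (Suc n) = real n * (1 + 1 / real n)" using n by (simp add: distrib_left)
  then have "ln (real (Suc n)) = ln (real n * (1 + 1 / real n))" by (rule arg_cong)
  also have "\<dots> = ln (real n) + ln (1 + 1 / real n)"
    using n add_pos_pos[of 1 "1 / real n"] by (intro ln_mult_pos) auto
  also have "ln (1 + 1 / real n) \<le> 1 / real n" using n by (intro ln_add_one_self_le_self) auto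
  finally have "ln (real (Suc n)) \<le> ln (real n) + 1 / real n" by simp
  also have "\<dots> = ln (real n) * (1 + 1 / (real n * ln (real n)))" using n by (simp add: field_simps)
  finally have "ln (ln (real (Suc n))) \<le> ln (ln (real n) * (1 + 1 / (real n * ln (real n))))"
    using assms by (subst ln_le_cancel_iff) (auto intro!: mult_pos_pos add_pos_nonneg)
  also have "\<dots> = ln (ln (real n)) + ln (1 + 1 / (real n * ln (real n)))"
    using n add_pos_pos[of 1 "1 / (real n * ln (real n))"] by (intro ln_mult_pos) auto
  also have "ln (1 + 1 / (real n * ln (real n))) \<le> 1 / (real n * ln (real n))"
    using n by (intro ln_add_one_self_le_self) auto
  finally show ?thesis by simp
qed

text \<open>Partial summation: \<open>1 / p\<close> is at least the telescoping sum of
  \<open>1 / (n * (n + 1))\<close> over \<open>p \<le> n \<le> y\<close>. Exchanging the sums puts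
  the counting function of \<open>G\<close> in the numerator, where the hypothesis yields terms of
  size \<open>1 / (n * ln n)\<close>, which dominate the increments of \<open>ln ln\<close>.\<close>

lemma sum_reciprocals_ge:
  fixes G :: "nat set"
  assumes G: "\<And>n. n \<ge> z \<Longrightarrow> \<kappa> * real n / ln (real n) \<le> real (card {p\<in>G. p \<le> n})"
    and "0 < \<kappa>" "2 \<le> z" "z \<le> y" "0 \<notin> G"
  shows "\<kappa> / 2 * (ln (ln (real (Suc y))) - ln (ln (real z))) \<le> (\<Sum>p\<in>{p\<in>G. p \<le> y}. 1 / real p)"
proof -
  have tel: "(\<Sum>n=a..y. 1 / (real n * real (Suc n))) = 1 / real a - 1 / real (Suc y)" if "1 \<le> a" "a \<le> y" for a
    using that(2,1)
  proof (induction y rule: dec_induct)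
    case base
    then show ?case by (simp add: field_simps)
  next
    case (step n)
    have "1 / (real (Suc n) * real (Suc (Suc n))) = 1 / real (Suc n) - 1 / real (Suc (Suc n))"
      by (simp add: divide_simps)
    then show ?case using step by simp
  qed
  have "\<kappa> / 2 * (ln (ln (real (Suc y))) - ln (ln (real z))) = \<kappa> / 2 * (\<Sum>n=z..y. ln (ln (real (Suc n))) - ln (ln (real n)))"
    using assms(4) by (subst sum_Suc_diff) auto
  also have "\<dots> \<le> (\<Sum>n=z..y. real (card {p\<in>G. p \<le> n}) / (real n * real (Suc n)))"
    unfolding sum_distrib_left
  proof (rule sum_mono)
    fix n assume n: "n \<in> {z..y}"
    have n2: "n \<ge> 2" using n assms(3) by simp
    then have pos: "real n > 0" "ln (real n) > 0" by auto
    have "\<kappa> / 2 * (ln (ln (real (Suc n))) - ln (ln (real n))) \<le> \<kappa> / 2 * (1 / (real n * ln (real n)))"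
      using ln_ln_Suc_diff_le[OF n2] assms(2) by (intro mult_left_mono) auto
    \<comment> \<open>Here \<open>n + 1 \<le> 2 * n\<close> uses up the factor
      \<open>1 / 2\<close>.\<close>
    also have "\<dots> \<le> \<kappa> / (real (Suc n) * ln (real n))"
    proof -
      have "\<kappa> / 2 * (1 / (real n * ln (real n))) = \<kappa> / (2 * real n * ln (real n))" by simp
      also have "\<dots> \<le> \<kappa> / (real (Suc n) * ln (real n))"
        using n2 pos assms(2) by (intro divide_left_mono mult_right_mono mult_pos_pos) auto
      finally show ?thesis .
    qed
    also have "\<dots> = (\<kappa> * real n / ln (real n)) / (real n * real (Suc n))"
      using pos by simp
    also have "\<dots> \<le> real (card {p\<in>G. p \<le> n}) / (real n * real (Suc n))"
      using G[of n] n by (intro divide_right_mono) auto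
    finally show "\<kappa> / 2 * (ln (ln (real (Suc n))) - ln (ln (real n)))
        \<le> real (card {p\<in>G. p \<le> n}) / (real n * real (Suc n))" .
  qed
  also have "\<dots> \<le> (\<Sum>n=1..y. real (card {p\<in>G. p \<le> n}) / (real n * real (Suc n)))"
    using assms(3) by (intro sum_mono2) auto
  also have "\<dots> = (\<Sum>n=1..y. \<Sum>p\<in>{p\<in>{p\<in>G. p \<le> y}. p \<le> n}. 1 / (real n * real (Suc n)))"
  proof (intro sum.cong refl)
    fix n assume "n \<in> {1..y}"
    then have "{p\<in>{p\<in>G. p \<le> y}. p \<le> n} = {p\<in>G. p \<le> n}" by auto
    then show "real (card {p\<in>G. p \<le> n}) / (real n * real (Suc n)) =
        (\<Sum>p\<in>{p\<in>{p\<in>G. p \<le> y}. p \<le> n}. 1 / (real n * real (Suc n)))" by simp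
  qed
  also have "\<dots> = (\<Sum>p\<in>{p\<in>G. p \<le> y}. \<Sum>n\<in>{n\<in>{1..y}. p \<le> n}. 1 / (real n * real (Suc n)))"
    by (rule sum.swap_restrict) auto
  also have "\<dots> \<le> (\<Sum>p\<in>{p\<in>G. p \<le> y}. 1 / real p)"
  proof (rule sum_mono)
    fix p assume p: "p \<in> {p\<in>G. p \<le> y}"
    have p1: "1 \<le> p" "p \<le> y" using p assms(5) by (cases p; auto)+
    then have "{n\<in>{1..y}. p \<le> n} = {p..y}" by auto
    then have "(\<Sum>n\<in>{n\<in>{1..y}. p \<le> n}. 1 / (real n * real (Suc n))) = 1 / real p - 1 / real (Suc y)"
      using tel[OF p1] by simp
    also have "\<dots> \<le> 1 / real p" by simp
    finally show "(\<Sum>n\<in>{n\<in>{1..y}. p \<le> n}. 1 / (real n * real (Suc n))) \<le> 1 / real p" .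
  qed
  finally show ?thesis .
qed

text \<open>For fixed \<open>p \<le> y\<close> the admissible \<open>q\<close> are the members of
  \<open>G\<close> in the interval from \<open>y\<close> (excluded) to \<open>Q div p\<close>, and
  their number is at least a constant times \<open>Q / (p * ln Q)\<close>. Summing over
  \<open>p\<close> produces the sum of reciprocals; \<open>\<kappa>^2 / 8\<close> is
  \<open>\<kappa> / 4\<close> from the count of \<open>q\<close> times \<open>\<kappa> / 2\<close>
  from that sum. Separating the two ranges at \<open>y\<close> makes \<open>p < q\<close>
  automatic.\<close>

lemma card_prime_pairs_ge:
  fixes G :: "nat set"
  assumes G: "\<And>n. n \<ge> z \<Longrightarrow> \<kappa> * real n / ln (real n) \<le> real (card {p\<in>G. p \<le> n})"
    and "0 < \<kappa>" "\<kappa> \<le> 1" "2 \<le> z" "z \<le> y" "0 \<notin> G"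
    and Q: "4 * (real y)\<^sup>2 * ln (real Q) \<le> \<kappa> * real Q" "3 \<le> Q"
  shows "\<kappa>\<^sup>2 / 8 * (real Q / ln (real Q)) * (ln (ln (real (Suc y))) - ln (ln (real z)))
    \<le> real (card {(p, q). p \<in> G \<and> p \<le> y \<and> q \<in> G \<and> y < q \<and> p * q \<le> Q})"
proof -
  define B where "B = (\<lambda>p. {q\<in>G. y < q \<and> p * q \<le> Q})"
  have lnQ: "ln (real Q) \<ge> 1" using Q(2) exp_le by (subst ln_ge_iff) auto
  have "(real y)\<^sup>2 * 4 \<le> (real y)\<^sup>2 * (4 * ln (real Q))" using lnQ by (intro mult_left_mono) auto
  also have "\<dots> \<le> real Q" using Q(1) assms(3) mult_right_mono[of \<kappa> 1 "real Q"] by simp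
  finally have "real (4 * y\<^sup>2) \<le> real Q" by simp
  then have yQ: "4 * y\<^sup>2 \<le> Q" by (simp only: of_nat_le_iff)
  have B: "\<kappa> / 4 * (real Q / ln (real Q)) * (1 / real p) \<le> real (card (B p))" and finB: "finite (B p)"
    if p: "p \<in> G" "p \<le> y" for p
  proof -
    define n where "n = Q div p"
    have p0: "p > 0" using p(1) assms(6) by (cases p) auto
    show "finite (B p)" by (rule finite_subset[of _ "{..Q}"]) (use p0 in \<open>auto simp: B_def intro: order_trans[rotated]\<close>)
    have "y * p \<le> y * y" using p by simp
    also have "\<dots> \<le> Q" using yQ by (simp add: power2_eq_square)
    finally have yn: "y \<le> n" using p0 by (simp add: n_def less_eq_div_iff_mult_less_eq)
    have n2: "n \<ge> 2" using yn assms(4,5) by simp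
    have nQ: "n \<le> Q" by (simp add: n_def)
    have "Q < p * (n + 1)" using p0 unfolding n_def by (metis Suc_eq_plus1 dividend_less_times_div mult_Suc_right add.commute)
    also have "\<dots> \<le> p * (2 * n)" using n2 by (intro mult_left_mono) auto
    finally have "Q \<le> p * (2 * n)" by simp
    then have "real Q \<le> real p * (2 * real n)" by (metis of_nat_le_iff of_nat_mult of_nat_numeral)
    then have nge: "real Q / (2 * real p) \<le> real n" using p0 by (simp add: field_simps)
    \<comment> \<open>Half of the count guaranteed up to \<open>Q div p\<close> pays for the at most
      \<open>y\<close> members of \<open>G\<close> that are not larger than \<open>y\<close>; the
      assumed size of \<open>Q\<close> relative to \<open>y^2 * ln Q\<close> is what makes this half
      suffice.\<close>
    have "\<kappa> / 4 * (real Q / ln (real Q)) * (1 / real p) + real y \<le> \<kappa> * (real Q / (2 * real p)) / ln (real Q)"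
    proof -
      have "real y * real p \<le> real y * real y" using p by (intro mult_left_mono) auto
      then have "real y * real p * (4 * ln (real Q)) \<le> real y * real y * (4 * ln (real Q))"
        using lnQ by (intro mult_right_mono) auto
      also have "\<dots> \<le> \<kappa> * real Q" using Q(1) by (simp add: power2_eq_square mult_ac)
      finally have "real y \<le> \<kappa> / 4 * (real Q / ln (real Q)) * (1 / real p)"
        using p0 lnQ by (simp add: field_simps)
      then show ?thesis by (simp add: field_simps)
    qed
    also have "\<dots> \<le> \<kappa> * real n / ln (real Q)"
      using nge assms(2) lnQ by (intro divide_right_mono mult_left_mono) auto
    also have "\<dots> \<le> \<kappa> * real n / ln (real n)"
      using n2 nQ assms(2) lnQ by (intro divide_left_mono mult_pos_pos) auto
    also have "\<dots> \<le> real (card {q\<in>G. q \<le> n})" using yn assms(5) by (intro G) auto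
    also have "\<dots> \<le> real (card (B p \<union> {0<..y}))"
    proof (intro of_nat_mono card_mono)
      show "finite (B p \<union> {0<..y})" using \<open>finite (B p)\<close> by simp
      show "{q\<in>G. q \<le> n} \<subseteq> B p \<union> {0<..y}"
      proof
        fix q assume q: "q \<in> {q\<in>G. q \<le> n}"
        then have "q > 0" using assms(6) by (cases q) auto
        moreover have "p * q \<le> Q"
          using q p0 by (simp add: n_def less_eq_div_iff_mult_less_eq mult.commute)
        ultimately show "q \<in> B p \<union> {0<..y}" using q by (auto simp: B_def)
      qed
    qed
    also have "\<dots> \<le> real (card (B p)) + real y"
      using card_Un_le[of "B p" "{0<..y}"] by simp
    finally show "\<kappa> / 4 * (real Q / ln (real Q)) * (1 / real p) \<le> real (card (B p))" by simp
  qed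
  have "\<kappa>\<^sup>2 / 8 * (real Q / ln (real Q)) * (ln (ln (real (Suc y))) - ln (ln (real z)))
    = \<kappa> / 4 * (real Q / ln (real Q)) * (\<kappa> / 2 * (ln (ln (real (Suc y))) - ln (ln (real z))))"
    by (simp add: power2_eq_square)
  also have "\<dots> \<le> \<kappa> / 4 * (real Q / ln (real Q)) * (\<Sum>p\<in>{p\<in>G. p \<le> y}. 1 / real p)"
    using assms lnQ by (intro mult_left_mono sum_reciprocals_ge) auto
  also have "\<dots> \<le> (\<Sum>p\<in>{p\<in>G. p \<le> y}. real (card (B p)))"
    unfolding sum_distrib_left using B by (intro sum_mono) auto
  also have "\<dots> = real (card (SIGMA p:{p\<in>G. p \<le> y}. B p))"
    using finB by (subst card_SigmaI) auto
  also have "(SIGMA p:{p\<in>G. p \<le> y}. B p) = {(p, q). p \<in> G \<and> p \<le> y \<and> q \<in> G \<and> y < q \<and> p * q \<le> Q}"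
    by (auto simp: B_def)
  finally show ?thesis .
qed

section \<open>Polynomial values in arithmetic progressions\<close>

lemma poly_cong_int:
  fixes f :: "int poly"
  assumes "[x = y] (mod m)"
  shows "[poly f x = poly f y] (mod m)"
  by (induction f) (auto intro!: cong_add cong_mult assms)

text \<open>As \<open>D\<close> is invertible modulo \<open>p\<close>, the map
  \<open>r \<mapsto> b + D * r\<close> is injective on residues, and it sends the residues of
  \<open>S\<close> to values of \<open>f\<close> modulo \<open>p\<close>.\<close>

lemma card_residues_progression_le:
  fixes f :: "int poly"
  assumes p: "prime p" "\<not> p dvd D"
    and S: "\<And>n. n \<in> S \<Longrightarrow> b + int D * int n \<in> range (poly f)"
  shows "card ((\<lambda>n. n mod p) ` S) \<le> card (poly_image_mod f p)"
proof (rule card_inj_on_le[where f = "\<lambda>r. (b + int D * int r) mod int p"])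
  have p0: "p > 0" using p(1) by (rule prime_gt_0_nat)
  show "finite (poly_image_mod f p)" by (simp add: poly_image_mod_def)
  show "inj_on (\<lambda>r. (b + int D * int r) mod int p) ((\<lambda>n. n mod p) ` S)"
  proof (rule inj_onI)
    fix r s assume *: "r \<in> (\<lambda>n. n mod p) ` S" "s \<in> (\<lambda>n. n mod p) ` S"
      "(b + int D * int r) mod int p = (b + int D * int s) mod int p"
    have "[int D * int r = int D * int s] (mod int p)"
      using *(3) unfolding cong_def[symmetric] by (simp only: cong_add_lcancel)
    then have "[D * r = D * s] (mod p)" by (simp flip: cong_int_iff)
    moreover have "coprime D p" using p prime_imp_coprime coprime_commute by blast
    ultimately have "[r = s] (mod p)" by (simp add: cong_mult_lcancel_nat)
    then show "r = s" using *(1,2) by (auto simp: cong_def)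
  qed
  show "(\<lambda>r. (b + int D * int r) mod int p) ` (\<lambda>n. n mod p) ` S \<subseteq> poly_image_mod f p"
  proof clarify
    fix n assume "n \<in> S"
    then obtain x where x: "b + int D * int n = poly f x" using S by blast
    have "[int (n mod p) = int n] (mod int p)" by (simp add: cong_def zmod_int)
    then have "[b + int D * int (n mod p) = b + int D * int n] (mod int p)"
      by (intro cong_add cong_mult cong_refl)
    moreover have "[poly f x = poly f (x mod int p)] (mod int p)"
      by (rule poly_cong_int) (simp add: cong_def)
    ultimately have "(b + int D * int (n mod p)) mod int p = poly f (x mod int p) mod int p"
      unfolding x by (simp add: cong_def)
    moreover have "x mod int p \<in> {0..<int p}" using p0 by simp
    ultimately show "(b + int D * int (n mod p)) mod int p \<in> poly_image_mod f p"
      unfolding poly_image_mod_def by auto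
  qed
qed

text \<open>Trades "all large indices" for "all large primes": the threshold is the prime at the
  critical index, since \<open>enumerate\<close> is increasing.\<close>

lemma shrinkingE:
  assumes "shrinking \<eta> \<mu> f"
  obtains P p\<^sub>0 where "eta_dense \<eta> P"
    "\<And>p. p \<in> P \<Longrightarrow> p\<^sub>0 \<le> p \<Longrightarrow> real (card (poly_image_mod f p)) \<le> \<mu> * real p"
proof -
  obtain P I where P: "eta_dense \<eta> P"
    and I: "\<And>i. i \<ge> I \<Longrightarrow> real (card (poly_image_mod f (enumerate P i))) < \<mu> * real (enumerate P i)"
    using assms unfolding shrinking_def eventually_sequentially by blast
  have inf: "infinite P" using P by (simp add: eta_dense_def)
  show ?thesis
  proof (rule that[OF P])
    fix p assume p: "p \<in> P" "enumerate P I \<le> p"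
    obtain i where i: "p = enumerate P i" using enumerate_Ex[OF inf p(1)] by auto
    have "I \<le> i"
    proof (rule ccontr)
      assume "\<not> I \<le> i"
      then have "enumerate P i < enumerate P I" using inf by (intro enumerate_mono) auto
      then show False using p(2) i by simp
    qed
    then show "real (card (poly_image_mod f p)) \<le> \<mu> * real p" using I[of i] i by simp
  qed
qed

section \<open>Sieve bounds for the values in one progression\<close>

lemma nat_floor_sqrt:
  fixes M :: nat
  assumes "2 \<le> sqrt (real M)"
  defines "Q \<equiv> nat \<lfloor>sqrt (real M)\<rfloor>"
  shows "Q\<^sup>2 \<le> M" "real Q \<le> sqrt (real M)" "sqrt (real M) - 1 < real Q" "sqrt (real M) / 2 \<le> real Q"
proof -
  have "real Q = of_int \<lfloor>sqrt (real M)\<rfloor>" using assms unfolding Q_def by simp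
  then show le: "real Q \<le> sqrt (real M)" and gt: "sqrt (real M) - 1 < real Q" by linarith+
  then show "sqrt (real M) / 2 \<le> real Q" using assms(1) by linarith
  have "(real Q)\<^sup>2 \<le> (sqrt (real M))\<^sup>2" using le by (intro power_mono) auto
  then have "real (Q\<^sup>2) \<le> real M" by simp
  then show "Q\<^sup>2 \<le> M" by (simp only: of_nat_le_iff)
qed

text \<open>The primes of \<open>G\<close> up to \<open>Q = \<lfloor>sqrt M\<rfloor>\<close> serve
  as moduli. The loss in \<open>Q \<ge> sqrt M / 2\<close> is offset by
  \<open>ln Q \<le> ln M / 2\<close>, so there are at least \<open>\<kappa> * sqrt M / ln M\<close>
  of them; \<open>z + 1 \<le> sqrt M\<close> puts \<open>Q\<close> in the range where the count is
  known.\<close>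

lemma card_sieved_le:
  fixes G S :: "nat set"
  assumes S: "S \<subseteq> {1..M}" and \<mu>: "0 < \<mu>" "\<mu> < 1" and \<kappa>: "0 < \<kappa>"
    and z: "2 \<le> z" "real z + 1 \<le> sqrt (real M)"
    and count: "\<And>n. n \<ge> z \<Longrightarrow> \<kappa> * real n / ln (real n) \<le> real (card {p\<in>G. p \<le> n})"
    and G: "\<And>p. p \<in> G \<Longrightarrow> prime p \<and> real (card ((\<lambda>n. n mod p) ` S)) \<le> \<mu> * real p"
  shows "real (card S) \<le> 8 / ((1 - \<mu>) * \<kappa>) * sqrt (real M) * ln (real M)"
proof -
  define Q where "Q = nat \<lfloor>sqrt (real M)\<rfloor>"
  have "2 \<le> sqrt (real M)" using z by linarith
  note Q = nat_floor_sqrt[OF this, folded Q_def]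
  have M: "real M > 1" using \<open>2 \<le> sqrt (real M)\<close> real_sqrt_gt_1_iff[of "real M"] by linarith
  have "real z < real Q" using Q(3) z(2) by linarith
  then have zQ: "z < Q" by simp
  have lnQ: "0 < ln (real Q)" "ln (real Q) \<le> ln (real M) / 2"
  proof -
    show "0 < ln (real Q)" using zQ z(1) by simp
    have "ln (real Q) \<le> ln (sqrt (real M))" using Q(2) zQ M by (subst ln_le_cancel_iff) auto
    then show "ln (real Q) \<le> ln (real M) / 2" using M by (simp add: ln_sqrt)
  qed
  have "\<kappa> * (sqrt (real M) / ln (real M)) = \<kappa> * ((sqrt (real M) / 2) / (ln (real M) / 2))" by simp
  also have "\<dots> \<le> \<kappa> * (real Q / ln (real Q))"
    using \<kappa> Q(4) lnQ M by (intro mult_left_mono frac_le) auto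
  also have "\<dots> \<le> real (card {p\<in>G. p \<le> Q})" using count[of Q] zQ by simp
  finally have "real (card S) * ((1 - \<mu>) * (\<kappa> * (sqrt (real M) / ln (real M))))
      \<le> real (card S) * ((1 - \<mu>) * real (card {p\<in>G. p \<le> Q}))"
    using \<mu> by (intro mult_left_mono) auto
  also have "\<dots> \<le> 8 * real M"
    using G \<mu> by (intro sieve_bound_primes[OF S Q(1)]) auto
  also have "8 * real M = 8 * sqrt (real M) * sqrt (real M)" by simp
  finally have "sqrt (real M) * (real (card S) * ((1 - \<mu>) * \<kappa>)) \<le> sqrt (real M) * (8 * sqrt (real M) * ln (real M))"
    using M by (simp add: field_simps)
  then have "real (card S) * ((1 - \<mu>) * \<kappa>) \<le> 8 * sqrt (real M) * ln (real M)"
    using M by (subst (asm) mult_le_cancel_left_pos) auto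
  then show ?thesis using \<mu> \<kappa> by (simp add: field_simps)
qed

text \<open>The same computation with pairs of primes; the difference of iterated logarithms on the
  left is the saving over prime moduli. The constant \<open>64\<close> is the \<open>8\<close> of
  the large sieve times the \<open>8\<close> in the lower bound for the number of pairs.\<close>

lemma card_sieved_pairs_le:
  fixes G S :: "nat set"
  assumes S: "S \<subseteq> {1..M}" and \<mu>: "0 < \<mu>" "\<mu> < 1" and \<kappa>: "0 < \<kappa>" "\<kappa> \<le> 1"
    and z: "2 \<le> z" "real z + 1 \<le> sqrt (real M)"
    and y: "z \<le> y" "4 * (real y)\<^sup>2 * ln (real M) \<le> \<kappa> * sqrt (real M)"
    and count: "\<And>n. n \<ge> z \<Longrightarrow> \<kappa> * real n / ln (real n) \<le> real (card {p\<in>G. p \<le> n})"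
    and G: "\<And>p. p \<in> G \<Longrightarrow> prime p \<and> real (card ((\<lambda>n. n mod p) ` S)) \<le> \<mu> * real p"
  shows "real (card S) * (ln (ln (real (Suc y))) - ln (ln (real z)))
    \<le> 64 / ((1 - \<mu>)\<^sup>2 * \<kappa>\<^sup>2) * sqrt (real M) * ln (real M)"
proof -
  define Q where "Q = nat \<lfloor>sqrt (real M)\<rfloor>"
  define \<Lambda> where "\<Lambda> = ln (ln (real (Suc y))) - ln (ln (real z))"
  define W where "W = {(p, q). p \<in> G \<and> p \<le> y \<and> q \<in> G \<and> y < q \<and> p * q \<le> Q}"
  have "2 \<le> sqrt (real M)" using z by linarith
  note Q = nat_floor_sqrt[OF this, folded Q_def]
  have M: "real M > 1" using \<open>2 \<le> sqrt (real M)\<close> real_sqrt_gt_1_iff[of "real M"] by linarith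
  have "real z < real Q" using Q(3) z(2) by linarith
  then have zQ: "z < Q" by simp
  have lnQ: "0 < ln (real Q)" "ln (real Q) \<le> ln (real M) / 2"
  proof -
    show "0 < ln (real Q)" using zQ z(1) by simp
    have "ln (real Q) \<le> ln (sqrt (real M))" using Q(2) zQ M by (subst ln_le_cancel_iff) auto
    then show "ln (real Q) \<le> ln (real M) / 2" using M by (simp add: ln_sqrt)
  qed
  have G0: "0 \<notin> G" using G by (metis not_prime_0)
  have "ln (real z) \<le> ln (real (Suc y))" using y(1) z(1) by (subst ln_le_cancel_iff) auto
  then have \<Lambda>: "\<Lambda> \<ge> 0" unfolding \<Lambda>_def using z(1) by simp
  have "4 * (real y)\<^sup>2 * ln (real Q) \<le> 4 * (real y)\<^sup>2 * (ln (real M) / 2)"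
    using lnQ by (intro mult_left_mono) auto
  also have "\<dots> \<le> \<kappa> * (sqrt (real M) / 2)" using y(2) by (simp add: field_simps)
  also have "\<dots> \<le> \<kappa> * real Q" using Q(4) \<kappa> by (intro mult_left_mono) auto
  finally have yQ: "4 * (real y)\<^sup>2 * ln (real Q) \<le> \<kappa> * real Q" .
  have "\<kappa>\<^sup>2 / 8 * (sqrt (real M) / ln (real M)) * \<Lambda> = \<kappa>\<^sup>2 / 8 * ((sqrt (real M) / 2) / (ln (real M) / 2)) * \<Lambda>" by simp
  also have "\<dots> \<le> \<kappa>\<^sup>2 / 8 * (real Q / ln (real Q)) * \<Lambda>"
    using Q(4) lnQ M \<Lambda> by (intro mult_right_mono mult_left_mono frac_le) auto
  also have "\<dots> \<le> real (card W)"
    unfolding \<Lambda>_def W_def using zQ z(1)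
    by (intro card_prime_pairs_ge[OF count \<kappa> z(1) y(1) G0 yQ]) auto
  finally have "real (card S) * ((1 - \<mu>)\<^sup>2 * (\<kappa>\<^sup>2 / 8 * (sqrt (real M) / ln (real M)) * \<Lambda>))
      \<le> real (card S) * ((1 - \<mu>)\<^sup>2 * real (card W))"
    using \<mu> by (intro mult_left_mono) auto
  also have "\<dots> \<le> 8 * real M"
  proof (rule sieve_bound_prime_pairs[OF S Q(1)])
    have pos: "p > 0" if "p \<in> G" for p using G0 that by (cases p) auto
    have "W \<subseteq> {..y} \<times> {..Q}"
    proof clarify
      fix p q assume "(p, q) \<in> W"
      then have "p \<le> y" "p * q \<le> Q" "p > 0" using pos by (auto simp: W_def)
      then show "p \<in> {..y} \<and> q \<in> {..Q}" using order_trans[of q "p * q" Q] by auto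
    qed
    then show "finite W" by (rule finite_subset) auto
    show "p < q \<and> p * q \<le> Q" if "(p, q) \<in> W" for p q using that by (auto simp: W_def)
    show "prime p \<and> real (card ((\<lambda>n. n mod p) ` S)) \<le> \<mu> * real p" if "p \<in> fst ` W \<union> snd ` W" for p
      using that by (intro G) (auto simp: W_def)
  qed (use \<mu> in auto)
  also have "8 * real M = 8 * sqrt (real M) * sqrt (real M)" by simp
  finally have "sqrt (real M) * (real (card S) * \<Lambda> * ((1 - \<mu>)\<^sup>2 * \<kappa>\<^sup>2)) \<le> sqrt (real M) * (64 * sqrt (real M) * ln (real M))"
    using M by (simp add: field_simps)
  then have "real (card S) * \<Lambda> * ((1 - \<mu>)\<^sup>2 * \<kappa>\<^sup>2) \<le> 64 * sqrt (real M) * ln (real M)"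
    using M by (subst (asm) mult_le_cancel_left_pos) auto
  then have "real (card S) * \<Lambda> \<le> 64 * sqrt (real M) * ln (real M) / ((1 - \<mu>)\<^sup>2 * \<kappa>\<^sup>2)"
    using \<mu> \<kappa> by (subst pos_le_divide_eq) auto
  then show ?thesis by (simp add: \<Lambda>_def)
qed

text \<open>The exponents in \<open>l = ln N\<close> are tied together. \<open>3/2 > 1\<close> lets
  the primes up to \<open>z\<close> outnumber the \<open>2 * l\<close> divisors of \<open>D\<close>,
  and \<open>5/4 = 3/2 * 5/6\<close> is what remains after removing \<open>ln z\<close>.
  \<open>7/2\<close> is twice \<open>7/4\<close>, which lies strictly between \<open>3/2\<close>, to
  reach beyond \<open>z\<close>, and \<open>2\<close>, to stay \<open>o(l^2)\<close> after
  multiplication by a logarithm. The power \<open>\<theta>/8\<close> leaves \<open>y^2\<close>, of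
  size \<open>N powr (\<theta>/4)\<close>, well below
  \<open>sqrt M > N powr (\<theta>/2)\<close>.\<close>

lemma asymp_conditions:
  fixes \<kappa> \<theta> \<delta> C\<^sub>1 C\<^sub>2 a b :: real
  assumes "0 < \<kappa>" "0 < \<theta>" "0 < \<delta>" "0 < C\<^sub>1" "0 < C\<^sub>2"
  shows "\<forall>\<^sub>F N::nat in sequentially. 1 \<le> ln (real N)"
    and "\<forall>\<^sub>F N::nat in sequentially. 2 \<le> \<delta>\<^sup>2 * (ln (real N))\<^sup>2"
    and "\<forall>\<^sub>F N::nat in sequentially. a \<le> ln (real N) powr (3/2)"
    and "\<forall>\<^sub>F N::nat in sequentially. 2 * ln (real N) + b \<le> \<kappa> * (ln (real N) powr (5/4) / 6)"
    and "\<forall>\<^sub>F N::nat in sequentially. ln (real N) powr (3/2) + 2 \<le> ln (real N) powr (7/4)"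
    and "\<forall>\<^sub>F N::nat in sequentially. C\<^sub>1 * sqrt (ln (real N) powr (7/2) + 1) * ln (ln (real N) powr (7/2) + 1) \<le> \<delta>\<^sup>2 * (ln (real N))\<^sup>2"
    and "\<forall>\<^sub>F N::nat in sequentially. ln (real N) powr (3/2) + 2 \<le> real N powr (\<theta>/8)"
    and "\<forall>\<^sub>F N::nat in sequentially. 4 * (real N powr (\<theta>/8))\<^sup>2 * ln (real N) \<le> \<kappa> * real N powr (\<theta>/2)"
    and "\<forall>\<^sub>F N::nat in sequentially. C\<^sub>2 / \<delta> \<le> ln (\<theta> / 8 * ln (real N)) - ln (ln (ln (real N) powr (3/2) + 1))"
proof -
  show "\<forall>\<^sub>F N::nat in sequentially. 1 \<le> ln (real N)" by real_asymp
  show "\<forall>\<^sub>F N::nat in sequentially. 2 \<le> \<delta>\<^sup>2 * (ln (real N))\<^sup>2" using assms by real_asymp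
  have "filterlim (\<lambda>N::nat. ln (real N) powr (3/2)) at_top sequentially" by real_asymp
  then show "\<forall>\<^sub>F N::nat in sequentially. a \<le> ln (real N) powr (3/2)" by (simp add: filterlim_at_top)
  have "filterlim (\<lambda>N::nat. \<kappa> * (ln (real N) powr (5/4) / 6) - 2 * ln (real N)) at_top sequentially"
    using assms by real_asymp
  then have "\<forall>\<^sub>F N::nat in sequentially. b \<le> \<kappa> * (ln (real N) powr (5/4) / 6) - 2 * ln (real N)"
    by (simp add: filterlim_at_top)
  then show "\<forall>\<^sub>F N::nat in sequentially. 2 * ln (real N) + b \<le> \<kappa> * (ln (real N) powr (5/4) / 6)"
    by eventually_elim linarith
  show "\<forall>\<^sub>F N::nat in sequentially. ln (real N) powr (3/2) + 2 \<le> ln (real N) powr (7/4)" by real_asymp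
  show "\<forall>\<^sub>F N::nat in sequentially. C\<^sub>1 * sqrt (ln (real N) powr (7/2) + 1) * ln (ln (real N) powr (7/2) + 1) \<le> \<delta>\<^sup>2 * (ln (real N))\<^sup>2"
    using assms by real_asymp
  show "\<forall>\<^sub>F N::nat in sequentially. ln (real N) powr (3/2) + 2 \<le> real N powr (\<theta>/8)"
    using assms by real_asymp
  show "\<forall>\<^sub>F N::nat in sequentially. 4 * (real N powr (\<theta>/8))\<^sup>2 * ln (real N) \<le> \<kappa> * real N powr (\<theta>/2)"
    using assms by real_asymp
  have "filterlim (\<lambda>N::nat. ln (\<theta> / 8 * ln (real N)) - ln (ln (ln (real N) powr (3/2) + 1))) at_top sequentially"
    using assms by real_asymp
  then show "\<forall>\<^sub>F N::nat in sequentially. C\<^sub>2 / \<delta> \<le> ln (\<theta> / 8 * ln (real N)) - ln (ln (ln (real N) powr (3/2) + 1))"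
    by (simp add: filterlim_at_top)
qed

text \<open>At most \<open>2 * l\<close> primes divide \<open>D\<close> and at most
  \<open>p\<^sub>0\<close> numbers lie below \<open>p\<^sub>0\<close>. For
  \<open>n \<ge> l powr (3/2)\<close> these exceptions cost at most half of the count
  \<open>2 * \<kappa> * n / ln n\<close>.\<close>

lemma card_coprime_primes_ge:
  assumes P: "\<And>p. p \<in> P \<Longrightarrow> prime p"
    and count: "2 * \<kappa> * real n / ln (real n) \<le> real (card {p\<in>P. p \<le> n})"
    and D: "0 < D" "D \<le> N"
    and n: "2 \<le> n" "l powr (3/2) \<le> real n" and l: "l = ln (real N)" "1 \<le> l" and \<kappa>: "0 < \<kappa>"
    and big: "2 * l + real p\<^sub>0 \<le> \<kappa> * (l powr (5/4) / 6)"
  shows "\<kappa> * real n / ln (real n) \<le> real (card {p\<in>{p\<in>P. p\<^sub>0 \<le> p \<and> \<not> p dvd D}. p \<le> n})"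
proof -
  have lnn: "ln (real n) > 0" using n by simp
  \<comment> \<open>The bound \<open>ln n \<le> 6 * n powr (1/6)\<close> gives
    \<open>n / ln n \<ge> n powr (5/6) / 6\<close>, which is at least
    \<open>l powr (5/4) / 6\<close>.\<close>
  have "ln (real n) \<le> real n powr (1/6) / (1/6)" using n by (intro ln_powr_bound) auto
  then have "ln (real n) \<le> 6 * real n powr (1/6)" by simp
  then have "real n powr (5/6) * ln (real n) \<le> real n powr (5/6) * (6 * real n powr (1/6))"
    by (intro mult_left_mono) auto
  also have "\<dots> = 6 * real n" using n by (simp flip: powr_add)
  finally have "real n powr (5/6) / 6 \<le> real n / ln (real n)" using lnn by (simp add: field_simps)
  moreover have "l powr (5/4) = (l powr (3/2)) powr (5/6)" by (simp add: powr_powr)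
  then have "l powr (5/4) \<le> real n powr (5/6)" using n by (simp add: powr_mono2)
  ultimately have "\<kappa> * (l powr (5/4) / 6) \<le> \<kappa> * (real n / ln (real n))"
    using \<kappa> by (intro mult_left_mono) auto
  moreover have "\<kappa> * (real n / ln (real n)) = \<kappa> * real n / ln (real n)" by simp
  ultimately have small: "2 * l + real p\<^sub>0 \<le> \<kappa> * real n / ln (real n)" using big by linarith
  define G where "G = {p\<in>{p\<in>P. p\<^sub>0 \<le> p \<and> \<not> p dvd D}. p \<le> n}"
  have finD: "finite {p. prime p \<and> p dvd D}"
    using D by (auto intro: finite_subset[OF _ finite_divisors_nat])
  have "card {p\<in>P. p \<le> n} \<le> card (G \<union> ({p. prime p \<and> p dvd D} \<union> {..<p\<^sub>0}))"
    using finD by (intro card_mono) (auto simp: G_def P not_le)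
  also have "\<dots> \<le> card G + card ({p. prime p \<and> p dvd D} \<union> {..<p\<^sub>0})" by (rule card_Un_le)
  also have "\<dots> \<le> card G + (card {p. prime p \<and> p dvd D} + p\<^sub>0)"
    using card_Un_le[of "{p. prime p \<and> p dvd D}" "{..<p\<^sub>0}"] by simp
  finally have "real (card {p\<in>P. p \<le> n}) \<le> real (card G) + (real (card {p. prime p \<and> p dvd D}) + real p\<^sub>0)"
    by linarith
  moreover have "real (card {p. prime p \<and> p dvd D}) \<le> 2 * l"
  proof -
    have "ln (real D) \<le> l" unfolding l(1) using D by (subst ln_le_cancel_iff) auto
    then show ?thesis using card_prime_divisors_le[OF D(1)] by linarith
  qed
  moreover have "2 * \<kappa> * real n / ln (real n) = \<kappa> * real n / ln (real n) + \<kappa> * real n / ln (real n)"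
    by (simp flip: add_divide_distrib)
  ultimately show ?thesis using count small unfolding G_def by linarith
qed

text \<open>The point is uniformity: a single threshold for \<open>N\<close> serves every
  \<open>D\<close>, \<open>b\<close> and \<open>M\<close>. The condition
  \<open>D * (M - 1) < N\<close> holds for any progression lying inside
  \<open>{1..N}\<close>.\<close>

lemma card_values_progression_le:
  fixes f :: "int poly"
  assumes sh: "shrinking \<eta> \<mu> f" and \<eta>: "0 < \<eta>" "\<eta> \<le> 1" and \<mu>: "0 < \<mu>" "\<mu> < 1" and \<delta>: "0 < \<delta>"
  shows "\<forall>\<^sub>F N in sequentially. \<forall>D b M. D > 0 \<longrightarrow> D * (M - 1) < N \<longrightarrow>
    real (card {n\<in>{1..M}. b + int D * int n \<in> range (poly f)}) \<le> \<delta> * ln (real N) * sqrt (real M)"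
proof -
  obtain P p\<^sub>0 where P: "eta_dense \<eta> P"
    and im: "\<And>p. p \<in> P \<Longrightarrow> p\<^sub>0 \<le> p \<Longrightarrow> real (card (poly_image_mod f p)) \<le> \<mu> * real p"
    using shrinkingE[OF sh] by blast
  have prime: "prime p" if "p \<in> P" for p using P that by (auto simp: eta_dense_def)
  \<comment> \<open>Half of the density constant \<open>\<eta> / 6\<close>; the other half is given
    up to the primes dividing \<open>D\<close> or lying below \<open>p\<^sub>0\<close>.\<close>
  define \<kappa> where "\<kappa> = \<eta> / 12"
  have \<kappa>: "0 < \<kappa>" "\<kappa> \<le> 1" using \<eta> by (auto simp: \<kappa>_def)
  obtain n\<^sub>0 where n0: "\<And>n. n \<ge> n\<^sub>0 \<Longrightarrow> 2 * \<kappa> * real n / ln (real n) \<le> real (card {p\<in>P. p \<le> n})"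
    using eta_dense_count[OF P \<eta>(1)] unfolding eventually_sequentially \<kappa>_def by auto
  define C\<^sub>1 where "C\<^sub>1 = 8 / ((1 - \<mu>) * \<kappa>)"
  define C\<^sub>2 where "C\<^sub>2 = 64 / ((1 - \<mu>)\<^sup>2 * \<kappa>\<^sup>2)"
  \<comment> \<open>Chosen so that \<open>C\<^sub>1 * \<theta> = \<delta>\<close>: the plain prime
    sieve is then good enough whenever \<open>ln M \<le> \<theta> * ln N\<close>.\<close>
  define \<theta> where "\<theta> = \<delta> / C\<^sub>1"
  have C: "0 < C\<^sub>1" "0 < C\<^sub>2" "0 < \<theta>" using \<mu> \<kappa> \<delta> by (auto simp: C\<^sub>1_def C\<^sub>2_def \<theta>_def)
  note ev = asymp_conditions[OF \<kappa>(1) C(3) \<delta> C(1,2)]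
  show ?thesis
    using ev(1,2) ev(3)[where a = "real n\<^sub>0 + 2"] ev(4)[where b = "real p\<^sub>0"] ev(5) ev(6) ev(7) ev(8) ev(9)
  proof eventually_elim
    case (elim N)
    define l where "l = ln (real N)"
    note e = elim[folded l_def]
    have N: "real N > 1"
    proof (rule ccontr)
      assume "\<not> real N > 1"
      then have "N = 0 \<or> N = 1" by linarith
      then show False using e(1) by (auto simp: l_def)
    qed
    define z where "z = nat \<lceil>l powr (3/2)\<rceil>"
    have z: "l powr (3/2) \<le> real z" "real z < l powr (3/2) + 1"
    proof -
      show "l powr (3/2) \<le> real z" unfolding z_def by (rule real_nat_ceiling_ge)
      have "real z = of_int \<lceil>l powr (3/2)\<rceil>" unfolding z_def by simp
      then show "real z < l powr (3/2) + 1" by linarith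
    qed
    have z2: "2 \<le> z" "n\<^sub>0 \<le> z" using z(1) e(3) by linarith+
    show ?case
    proof (intro allI impI)
      fix D M :: nat and b :: int
      assume D0: "D > 0" and DM: "D * (M - 1) < N"
      define S where "S = {n\<in>{1..M}. b + int D * int n \<in> range (poly f)}"
      have SM: "S \<subseteq> {1..M}" by (auto simp: S_def)
      have "real (card S) \<le> \<delta> * l * sqrt (real M)"
      proof (cases "real M \<le> \<delta>\<^sup>2 * l\<^sup>2")
        case True
        have "sqrt (real M) \<le> sqrt ((\<delta> * l)\<^sup>2)"
          using True by (intro real_sqrt_le_mono) (simp add: power_mult_distrib)
        then have "sqrt (real M) \<le> \<delta> * l" using \<delta> e(1) by simp
        then have "sqrt (real M) * sqrt (real M) \<le> \<delta> * l * sqrt (real M)"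
          by (intro mult_right_mono) auto
        moreover have "real (card S) \<le> real M" using card_mono[OF _ SM] by simp
        ultimately show ?thesis by simp
      next
        case False
        then have M2: "M \<ge> 2" using e(2) by linarith
        \<comment> \<open>For \<open>M \<ge> 2\<close> the spread bounds both \<open>D\<close>,
          which limits its prime divisors, and \<open>M\<close>, which gives
          \<open>ln M \<le> l\<close>.\<close>
        have "D * 1 \<le> D * (M - 1)" using M2 by (intro mult_left_mono) auto
        then have DN: "D \<le> N" using DM by linarith
        have "1 * (M - 1) \<le> D * (M - 1)" using D0 by (intro mult_right_mono) auto
        then have MN: "M \<le> N" using DM by linarith
        define G where "G = {p\<in>P. p\<^sub>0 \<le> p \<and> \<not> p dvd D}"
        have count: "\<kappa> * real n / ln (real n) \<le> real (card {p\<in>G. p \<le> n})" if "n \<ge> z" for n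
          unfolding G_def
        proof (rule card_coprime_primes_ge[OF prime n0 D0 DN _ _ l_def e(1) \<kappa>(1) e(4)])
          show "n\<^sub>0 \<le> n" "2 \<le> n" using that z2 by auto
          show "l powr (3/2) \<le> real n" using z(1) that by linarith
        qed
        have G: "prime p \<and> real (card ((\<lambda>n. n mod p) ` S)) \<le> \<mu> * real p" if "p \<in> G" for p
        proof -
          have p: "p \<in> P" "p\<^sub>0 \<le> p" "\<not> p dvd D" using that by (auto simp: G_def)
          have "card ((\<lambda>n. n mod p) ` S) \<le> card (poly_image_mod f p)"
            using prime[OF p(1)] p(3) by (intro card_residues_progression_le[of p D S b f]) (auto simp: S_def)
          then show ?thesis using im[OF p(1,2)] prime[OF p(1)] by linarith
        qed
        have lM: "\<delta> * l \<le> sqrt (real M)"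
          using False \<delta> e(1) by (intro real_le_rsqrt) (simp add: power_mult_distrib)
        \<comment> \<open>Shorter progressions are lengthened to \<open>M\<^sub>1\<close>: only from there on the primes up to \<open>sqrt M\<^sub>1\<close>
          certainly outnumber those dividing \<open>D\<close>, and the bound is still \<open>o((ln N)^2)\<close>.\<close>
        define M\<^sub>1 where "M\<^sub>1 = nat \<lceil>l powr (7/2)\<rceil>"
        have M1: "l powr (7/2) \<le> real M\<^sub>1" "real M\<^sub>1 < l powr (7/2) + 1"
        proof -
          show "l powr (7/2) \<le> real M\<^sub>1" unfolding M\<^sub>1_def by (rule real_nat_ceiling_ge)
          have "real M\<^sub>1 = of_int \<lceil>l powr (7/2)\<rceil>" unfolding M\<^sub>1_def by simp
          then show "real M\<^sub>1 < l powr (7/2) + 1" by linarith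
        qed
        have zM1: "real z + 1 \<le> sqrt (real M\<^sub>1)"
        proof -
          have "l powr (7/4) = sqrt (l powr (7/2))"
            using powr_half_sqrt_powr[of l "7/2"] e(1) by simp
          then have "l powr (7/4) \<le> sqrt (real M\<^sub>1)" using M1(1) by simp
          then show ?thesis using z(2) e(5) by linarith
        qed
        consider "real N powr \<theta> < real M" | "real M \<le> real N powr \<theta>" "M\<^sub>1 \<le> M" | "M \<le> M\<^sub>1" by linarith
        then show ?thesis
        proof cases
          case 1
          define y where "y = nat \<lfloor>real N powr (\<theta>/8)\<rfloor>"
          have "real y = of_int \<lfloor>real N powr (\<theta>/8)\<rfloor>" unfolding y_def by simp
          then have y: "real y \<le> real N powr (\<theta>/8)" "real N powr (\<theta>/8) < real (Suc y)" by linarith+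
          have zy: "z \<le> y" using y(2) z(2) e(7) by linarith
          have "real N powr (\<theta>/2) = sqrt (real N powr \<theta>)" by (simp add: powr_half_sqrt_powr)
          also have "\<dots> \<le> sqrt (real M)" using 1 by simp
          finally have sM: "real N powr (\<theta>/2) \<le> sqrt (real M)" .
          have "real N powr (\<theta>/8) \<le> real N powr (\<theta>/2)" using N C(3) by (intro powr_mono) auto
          then have zM: "real z + 1 \<le> sqrt (real M)" using z(2) e(7) sM by linarith
          have lnM: "0 \<le> ln (real M)" "ln (real M) \<le> l" unfolding l_def using M2 MN by auto
          have "4 * (real y)\<^sup>2 * ln (real M) \<le> 4 * (real N powr (\<theta>/8))\<^sup>2 * l"
            using y(1) lnM by (intro mult_mono power_mono) auto
          also have "\<dots> \<le> \<kappa> * real N powr (\<theta>/2)" by (rule e(8))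
          also have "\<dots> \<le> \<kappa> * sqrt (real M)" using sM \<kappa> by (intro mult_left_mono) auto
          finally have yM: "4 * (real y)\<^sup>2 * ln (real M) \<le> \<kappa> * sqrt (real M)" .
          have "\<theta> / 8 * l = ln (real N powr (\<theta>/8))" using N by (simp add: l_def ln_powr)
          also have "\<dots> \<le> ln (real (Suc y))" using y N by (subst ln_le_cancel_iff) auto
          finally have le: "\<theta> / 8 * l \<le> ln (real (Suc y))" .
          have "0 < \<theta> / 8 * l" using C(3) e(1) by simp
          then have "ln (\<theta> / 8 * l) \<le> ln (ln (real (Suc y)))"
            using le by (subst ln_le_cancel_iff) linarith+
          moreover have "ln (ln (real z)) \<le> ln (ln (l powr (3/2) + 1))"
          proof -
            have "ln (real z) \<le> ln (l powr (3/2) + 1)" using z(2) z2 by (subst ln_le_cancel_iff) auto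
            moreover have "0 < ln (real z)" using z2 by simp
            ultimately show ?thesis by (subst ln_le_cancel_iff) linarith+
          qed
          ultimately have "C\<^sub>2 / \<delta> \<le> ln (ln (real (Suc y))) - ln (ln (real z))" using e(9) by linarith
          then have "real (card S) * (C\<^sub>2 / \<delta>) \<le> real (card S) * (ln (ln (real (Suc y))) - ln (ln (real z)))"
            by (intro mult_left_mono) auto
          also have "\<dots> \<le> C\<^sub>2 * sqrt (real M) * ln (real M)"
            unfolding C\<^sub>2_def by (rule card_sieved_pairs_le[OF SM \<mu> \<kappa> z2(1) zM zy yM count G])
          also have "\<dots> \<le> C\<^sub>2 * sqrt (real M) * l" using C lnM by (intro mult_left_mono) auto
          finally have "C\<^sub>2 * real (card S) \<le> C\<^sub>2 * (\<delta> * l * sqrt (real M))"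
            using \<delta> by (simp add: field_simps)
          then show ?thesis using C by (subst (asm) mult_le_cancel_left_pos) auto
        next
          case 2
          have "sqrt (real M\<^sub>1) \<le> sqrt (real M)" using 2 by simp
          then have zM: "real z + 1 \<le> sqrt (real M)" using zM1 by linarith
          have "ln (real M) \<le> ln (real N powr \<theta>)" using 2(1) M2 N by (subst ln_le_cancel_iff) auto
          also have "\<dots> = \<theta> * l" using N by (simp add: l_def ln_powr)
          finally have "ln (real M) \<le> \<theta> * l" .
          have "real (card S) \<le> C\<^sub>1 * sqrt (real M) * ln (real M)"
            unfolding C\<^sub>1_def by (rule card_sieved_le[OF SM \<mu> \<kappa>(1) z2(1) zM count G])
          also have "\<dots> \<le> C\<^sub>1 * sqrt (real M) * (\<theta> * l)"
            using \<open>ln (real M) \<le> \<theta> * l\<close> C by (intro mult_left_mono) auto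
          also have "\<dots> = \<delta> * l * sqrt (real M)" using C by (simp add: \<theta>_def)
          finally show ?thesis .
        next
          case 3
          then have SM1: "S \<subseteq> {1..M\<^sub>1}" using SM by auto
          have "M\<^sub>1 \<ge> 2" using 3 M2 by simp
          have "real (card S) \<le> C\<^sub>1 * sqrt (real M\<^sub>1) * ln (real M\<^sub>1)"
            unfolding C\<^sub>1_def by (rule card_sieved_le[OF SM1 \<mu> \<kappa>(1) z2(1) zM1 count G])
          also have "\<dots> \<le> C\<^sub>1 * sqrt (l powr (7/2) + 1) * ln (l powr (7/2) + 1)"
            using M1 \<open>M\<^sub>1 \<ge> 2\<close> C by (intro mult_mono mult_left_mono) auto
          also have "\<dots> \<le> \<delta>\<^sup>2 * l\<^sup>2" by (rule e(6))
          also have "\<dots> = \<delta> * l * (\<delta> * l)" by (simp add: power2_eq_square)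
          \<comment> \<open>The negated first case, \<open>sqrt M \<ge> \<delta> * l\<close>,
            converts one of the two factors.\<close>
          also have "\<dots> \<le> \<delta> * l * sqrt (real M)" using lM \<delta> e(1) by (intro mult_left_mono) auto
          finally show ?thesis .
        qed
      qed
      then show "real (card {n\<in>{1..M}. b + int D * int n \<in> range (poly f)}) \<le> \<delta> * ln (real N) * sqrt (real M)"
        by (simp add: S_def l_def)
    qed
  qed
qed

section \<open>Quasi progressions\<close>

lemma sum_sqrt_le:
  assumes "\<And>i. i \<in> I \<Longrightarrow> 0 \<le> f i"
  shows "(\<Sum>i\<in>I. sqrt (f i)) \<le> sqrt (real (card I) * (\<Sum>i\<in>I. f i))"
proof -
  have "(\<Sum>i\<in>I. sqrt (f i))\<^sup>2 \<le> (\<Sum>i\<in>I. (sqrt (f i))\<^sup>2) * real (card I)"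
    by (rule sum_squared_le_sum_of_squares)
  also have "(\<Sum>i\<in>I. (sqrt (f i))\<^sup>2) = (\<Sum>i\<in>I. f i)" using assms by (intro sum.cong) auto
  finally show ?thesis by (intro real_le_rsqrt) (simp add: mult.commute)
qed

lemma convex_nat_set_eq_interval:
  fixes I :: "nat set"
  assumes "finite I" "I \<noteq> {}" "\<And>i j k. i \<in> I \<Longrightarrow> k \<in> I \<Longrightarrow> i \<le> j \<Longrightarrow> j \<le> k \<Longrightarrow> j \<in> I"
  shows "I = {Min I..<Min I + card I}"
proof -
  have "I = {Min I..Max I}"
  proof
    show "I \<subseteq> {Min I..Max I}" using assms(1) by auto
    show "{Min I..Max I} \<subseteq> I"
      using assms(3)[OF Min_in[OF assms(1,2)] Max_in[OF assms(1,2)]] by auto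
  qed
  then have "card I = Suc (Max I) - Min I" by (metis card_atLeastAtMost)
  moreover have "Min I \<le> Max I" using assms(1,2) by simp
  ultimately have "{Min I..<Min I + card I} = {Min I..Max I}" by auto
  then show ?thesis using \<open>I = {Min I..Max I}\<close> by simp
qed

text \<open>\<open>J\<close> holds the positions of the long gaps and \<open>c i\<close> counts
  those before index \<open>i\<close>. Where \<open>c\<close> is constant the elements form a
  genuine progression of difference \<open>D\<close>, and \<open>c\<close> takes values in
  \<open>{0..card J}\<close>. So there are at most \<open>card J + 1\<close> pieces, and
  Cauchy-Schwarz bounds the sum of the square roots of their lengths.\<close>

lemma card_quasi_progression_Int_le:
  fixes V :: "int set"
  assumes X: "cp_qp D X" "X \<subseteq> {1..int N}"
    and K: "K \<ge> 0"
    and AP: "\<And>b M. D * (M - 1) < N \<Longrightarrow>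
      real (card {n\<in>{1..M}. b + int D * int n \<in> V}) \<le> K * sqrt (real M)"
  shows "real (card (X \<inter> V)) \<le>
    K * sqrt ((real (card {i. Suc i < card X \<and> gap X i = int D + 1}) + 1) * real (card X))"
proof -
  define xs where "xs = sorted_list_of_set X"
  define k where "k = card X"
  define J where "J = {i. Suc i < k \<and> gap X i = int D + 1}"
  define c where "c = (\<lambda>i. card {j\<in>J. j < i})"
  have gap: "gap X i = int D \<or> gap X i = int D + 1" if "Suc i < k" for i
    using X(1) that by (auto simp: cp_qp_def k_def)
  have fin: "finite X" using X(1) by (simp add: cp_qp_def)
  have xs: "length xs = k" "set xs = X" "distinct xs" using fin by (auto simp: xs_def k_def)
  have finJ: "finite J" by (rule finite_subset[of _ "{..k}"]) (auto simp: J_def)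
  have c_le: "c i \<le> card J" for i unfolding c_def by (intro card_mono finJ) auto
  have c_mono: "c i \<le> c j" if "i \<le> j" for i j
    unfolding c_def using that by (intro card_mono) (auto intro: finite_subset[OF _ finJ])
  have xs_nth: "xs ! i = xs ! 0 + int D * int i + int (c i)" if "i < k" for i
    using that
  proof (induction i)
    case 0
    then show ?case by (simp add: c_def)
  next
    case (Suc i)
    have g: "xs ! Suc i = xs ! i + gap X i" by (simp add: gap_def xs_def)
    have "{j\<in>J. j < Suc i} = (if i \<in> J then insert i {j\<in>J. j < i} else {j\<in>J. j < i})"
      by (auto simp: less_Suc_eq)
    then have "c (Suc i) = (if i \<in> J then Suc (c i) else c i)"
      unfolding c_def using finJ by auto
    moreover have "gap X i = int D + (if i \<in> J then 1 else 0)"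
      using gap[of i] Suc.prems by (auto simp: J_def)
    ultimately show ?case using g Suc by (auto simp: algebra_simps)
  qed
  define I where "I = (\<lambda>l. {i\<in>{..<k}. c i = l})"
  have piece: "real (card {i\<in>I l. xs ! i \<in> V}) \<le> K * sqrt (real (card (I l)))" for l
  proof (cases "I l = {}")
    case False
    define m where "m = Min (I l)"
    define M where "M = card (I l)"
    have finI: "finite (I l)" by (simp add: I_def)
    have Ieq: "I l = {m..<m + M}"
      unfolding m_def M_def
    proof (rule convex_nat_set_eq_interval[OF finI False])
      fix i j k' assume *: "i \<in> I l" "k' \<in> I l" "i \<le> j" "j \<le> k'"
      then have "c i \<le> c j" "c j \<le> c k'" using c_mono by auto
      then show "j \<in> I l" using * by (auto simp: I_def)
    qed
    have M: "M > 0" using False finI by (simp add: M_def card_gt_0_iff)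
    have nth: "xs ! i = xs ! 0 + int D * int i + int l" if "i \<in> I l" for i
    proof -
      have "i < k" "c i = l" using that by (simp_all add: I_def)
      then show ?thesis using xs_nth[of i] by simp
    qed
    \<comment> \<open>One step before the first element of the piece, so that \<open>n = 1\<close>
      corresponds to index \<open>m\<close>.\<close>
    define b where "b = xs ! 0 + int l + int D * (int m - 1)"
    have mem: "m \<in> I l" "m + (M - 1) \<in> I l" unfolding Ieq using M by simp_all
    then have "m < k" "m + (M - 1) < k" by (auto simp: I_def)
    then have "xs ! m \<in> {1..int N}" "xs ! (m + (M - 1)) \<in> {1..int N}"
      using xs X(2) nth_mem by blast+
    moreover have "xs ! (m + (M - 1)) - xs ! m = int D * int (M - 1)"
      using nth[OF mem(1)] nth[OF mem(2)] by (simp add: algebra_simps)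
    ultimately have "int D * int (M - 1) < int N" by auto
    then have DM: "D * (M - 1) < N" by (metis of_nat_less_iff of_nat_mult)
    have "card {i\<in>I l. xs ! i \<in> V} \<le> card {n\<in>{1..M}. b + int D * int n \<in> V}"
    proof (rule card_inj_on_le[where f = "\<lambda>i. i - m + 1"])
      show "inj_on (\<lambda>i. i - m + 1) {i\<in>I l. xs ! i \<in> V}"
        by (rule inj_onI) (auto simp: Ieq)
      show "(\<lambda>i. i - m + 1) ` {i\<in>I l. xs ! i \<in> V} \<subseteq> {n\<in>{1..M}. b + int D * int n \<in> V}"
      proof clarify
        fix i assume i: "i \<in> I l" "xs ! i \<in> V"
        then have mi: "m \<le> i" "i < m + M" using Ieq by auto
        then have "b + int D * int (i - m + 1) = xs ! i"
          unfolding nth[OF i(1)] b_def by (simp add: of_nat_diff algebra_simps)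
        then show "i - m + 1 \<in> {1..M} \<and> b + int D * int (i - m + 1) \<in> V" using mi i(2) by auto
      qed
    qed simp
    then show ?thesis using AP[OF DM, of b] unfolding M_def by linarith
  qed simp
  have Isum: "(\<Sum>l\<in>{..card J}. card (A \<inter> I l)) = card A" if "A \<subseteq> {..<k}" for A
  proof -
    have "(\<Sum>l\<in>{..card J}. card (A \<inter> I l)) = card (\<Union>l\<in>{..card J}. A \<inter> I l)"
      by (intro card_UN_disjoint[symmetric]) (auto simp: I_def intro: finite_subset[OF that])
    also have "(\<Union>l\<in>{..card J}. A \<inter> I l) = A" using that c_le by (auto simp: I_def)
    finally show ?thesis .
  qed
  have "card (X \<inter> V) = card {i\<in>{..<k}. xs ! i \<in> V}"
  proof -
    have "bij_betw (\<lambda>i. xs ! i) {..<k} X" using xs by (intro bij_betw_nth) auto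
    then have "bij_betw (\<lambda>i. xs ! i) {i\<in>{..<k}. xs ! i \<in> V} (X \<inter> V)"
      by (auto simp: bij_betw_def intro: inj_on_subset)
    then show ?thesis using bij_betw_same_card by metis
  qed
  also have "\<dots> = (\<Sum>l\<in>{..card J}. card ({i\<in>{..<k}. xs ! i \<in> V} \<inter> I l))"
    by (intro Isum[symmetric]) auto
  also have "\<dots> = (\<Sum>l\<in>{..card J}. card {i\<in>I l. xs ! i \<in> V})"
    by (intro sum.cong refl arg_cong[where f = card]) (auto simp: I_def)
  finally have "real (card (X \<inter> V)) = (\<Sum>l\<in>{..card J}. real (card {i\<in>I l. xs ! i \<in> V}))" by simp
  also have "\<dots> \<le> K * (\<Sum>l\<in>{..card J}. sqrt (real (card (I l))))"
    unfolding sum_distrib_left by (intro sum_mono piece)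
  also have "(\<Sum>l\<in>{..card J}. sqrt (real (card (I l)))) \<le>
      sqrt (real (card {..card J}) * (\<Sum>l\<in>{..card J}. real (card (I l))))"
    by (rule sum_sqrt_le) simp
  also have "(\<Sum>l\<in>{..card J}. real (card (I l))) = real (\<Sum>l\<in>{..card J}. card ({..<k} \<inter> I l))"
    by (simp add: I_def Int_def cong: conj_cong)
  also have "\<dots> = real k" by (subst Isum) auto
  finally show ?thesis using K by (simp add: mult_left_mono k_def J_def add.commute)
qed

text \<open>Each \<open>X i\<close> contributes at most a multiple of
  \<open>sqrt (card (X i))\<close>; the second Cauchy-Schwarz, over the \<open>T\<close> sets,
  produces exactly the quantity minimised in \<open>H\<close>. Allowing a larger set
  \<open>V\<close> in place of \<open>S\<close> lets the bound be used with the full range of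
  \<open>f\<close>.\<close>

lemma cover_bound:
  fixes V :: "int set"
  assumes cover: "qp_cover A N S T X" and SV: "S \<subseteq> V"
    and K: "K \<ge> 0" and N: "ln (real N) \<ge> 1" "A > 0"
    and AP: "\<And>D b M. D > 0 \<Longrightarrow> D * (M - 1) < N \<Longrightarrow>
      real (card {n\<in>{1..M}. b + int D * int n \<in> V}) \<le> K * sqrt (real M)"
  shows "(real (card S))\<^sup>2 \<le> 2 * K\<^sup>2 * ln (real N) powr A * real (T * (\<Sum>i=1..T. card (X i)))"
proof -
  define L where "L = ln (real N) powr A"
  have L: "L \<ge> 1" unfolding L_def using N by (intro ge_one_powr_ge_zero) auto
  have each: "real (card (X i \<inter> V)) \<le> K * sqrt (2 * L) * sqrt (real (card (X i)))" if i: "i \<in> {1..T}" for i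
  proof -
    obtain D where D: "cp_qp_log A N D (X i)" and sub: "X i \<subseteq> {1..int N}"
      using cover i unfolding qp_cover_def by blast
    have qp: "cp_qp D (X i)" using D by (simp add: cp_qp_log_def)
    then have "D > 0" by (simp add: cp_qp_def)
    have "real (card (X i \<inter> V)) \<le>
      K * sqrt ((real (card {j. Suc j < card (X i) \<and> gap (X i) j = int D + 1}) + 1) * real (card (X i)))"
      using AP[OF \<open>D > 0\<close>] by (rule card_quasi_progression_Int_le[OF qp sub K])
    \<comment> \<open>At most \<open>L\<close> long gaps give \<open>L + 1 \<le> 2 * L\<close>; here
      \<open>L \<ge> 1\<close> comes from \<open>ln N \<ge> 1\<close>.\<close>
    also have "\<dots> \<le> K * sqrt ((2 * L) * real (card (X i)))"
      using D L K unfolding cp_qp_log_def L_def by (intro mult_left_mono real_sqrt_le_mono mult_right_mono) auto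
    also have "\<dots> = K * sqrt (2 * L) * sqrt (real (card (X i)))" by (simp add: real_sqrt_mult)
    finally show ?thesis .
  qed
  have finX: "finite (X i)" if "i \<in> {1..T}" for i
    using cover that unfolding qp_cover_def by (meson finite_atLeastAtMost_int finite_subset)
  have "S \<subseteq> (\<Union>i\<in>{1..T}. X i \<inter> V)" using cover SV unfolding qp_cover_def by blast
  then have "card S \<le> card (\<Union>i\<in>{1..T}. X i \<inter> V)" using finX by (intro card_mono) auto
  also have "\<dots> \<le> (\<Sum>i=1..T. card (X i \<inter> V))" by (rule card_UN_le) simp
  finally have "real (card S) \<le> (\<Sum>i=1..T. real (card (X i \<inter> V)))"
    by (metis of_nat_le_iff of_nat_sum)
  also have "\<dots> \<le> (\<Sum>i=1..T. K * sqrt (2 * L) * sqrt (real (card (X i))))"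
    by (intro sum_mono each)
  also have "\<dots> = K * sqrt (2 * L) * (\<Sum>i=1..T. sqrt (real (card (X i))))"
    by (simp add: sum_distrib_left)
  also have "\<dots> \<le> K * sqrt (2 * L) * sqrt (real (card {1..T}) * (\<Sum>i=1..T. real (card (X i))))"
    using K L by (intro mult_left_mono sum_sqrt_le) auto
  finally have "(real (card S))\<^sup>2 \<le> (K * sqrt (2 * L) * sqrt (real T * (\<Sum>i=1..T. real (card (X i)))))\<^sup>2"
    by (intro power_mono) auto
  also have "\<dots> = K\<^sup>2 * (2 * L) * (real T * (\<Sum>i=1..T. real (card (X i))))"
    using L by (simp add: power_mult_distrib sum_nonneg)
  finally show ?thesis by (simp add: L_def mult_ac)
qed

section \<open>Counting polynomial values and choosing the constants\<close>

lemma poly_upper_bound: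
  fixes f :: "int poly"
  obtains C where "C > 0" "\<And>n. n \<ge> 1 \<Longrightarrow> real_of_int (poly f (int n)) \<le> C * real n ^ degree f"
proof
  define C where "C = (\<Sum>i\<le>degree f. \<bar>real_of_int (coeff f i)\<bar>) + 1"
  show "C > 0" unfolding C_def by (intro add_nonneg_pos sum_nonneg) auto
  fix n :: nat assume n: "n \<ge> 1"
  have "real_of_int (poly f (int n)) = (\<Sum>i\<le>degree f. real_of_int (coeff f i) * real n ^ i)"
    by (simp add: poly_altdef)
  also have "\<dots> \<le> (\<Sum>i\<le>degree f. \<bar>real_of_int (coeff f i)\<bar> * real n ^ degree f)"
    using n by (intro sum_mono mult_mono power_increasing) auto
  also have "\<dots> \<le> C * real n ^ degree f"
    unfolding C_def sum_distrib_right[symmetric] by (intro mult_right_mono) auto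
  finally show "real_of_int (poly f (int n)) \<le> C * real n ^ degree f" .
qed

text \<open>All arguments from a fixed \<open>n0\<close> up to \<open>(N / C) powr (1 / d)\<close>
  give values in \<open>{1..N}\<close>, and each value is taken at most \<open>d\<close> times
  because \<open>f - v\<close> has at most \<open>d\<close> roots.\<close>

lemma card_values_upto_ge:
  fixes f :: "int poly"
  assumes "degree f \<ge> 1" "lead_coeff f > 0"
  obtains c where "c > 0"
    "\<forall>\<^sub>F N in sequentially. c * real N powr (1 / real (degree f)) \<le> real (card (values_upto f N))"
proof -
  define d where "d = degree f"
  have d: "real d > 0" "d \<ge> 1" using assms(1) by (auto simp: d_def)
  obtain C where C: "C > 0" "\<And>n. n \<ge> 1 \<Longrightarrow> real_of_int (poly f (int n)) \<le> C * real n ^ d"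
    using poly_upper_bound[of f] unfolding d_def by blast
  define g where "g = map_poly real_of_int f"
  have g: "lead_coeff g = real_of_int (lead_coeff f)"
    by (simp add: g_def degree_map_poly coeff_map_poly)
  have poly_g: "poly g (real_of_int x) = real_of_int (poly f x)" for x
    unfolding g_def by (induction f) (auto simp: map_poly_pCons)
  obtain x0 :: real where x0: "\<And>x. x \<ge> x0 \<Longrightarrow> poly g x \<ge> lead_coeff g"
    using poly_pinfty_gt_lc[of g] assms(2) g by auto
  define n0 where "n0 = nat \<lceil>x0\<rceil> + 1"
  have f_pos: "poly f (int n) \<ge> 1" if "n \<ge> n0" for n
  proof -
    have "real n \<ge> x0" using that unfolding n0_def by linarith
    then have "real_of_int (poly f (int n)) \<ge> real_of_int (lead_coeff f)"
      using x0[of "real n"] poly_g[of "int n"] g by simp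
    then show ?thesis using assms(2) by linarith
  qed
  \<comment> \<open>The factor \<open>2\<close> allows for the arguments below \<open>n0\<close>,
    the factor \<open>d\<close> for repeated values.\<close>
  define c where "c = 1 / (2 * real d * C powr (1 / real d))"
  have "c > 0" using C(1) d by (simp add: c_def)
  moreover have "\<forall>\<^sub>F N in sequentially. c * real N powr (1 / real d) \<le> real (card (values_upto f N))"
  proof -
    have "filterlim (\<lambda>N::nat. (real N / C) powr (1 / real d)) at_top sequentially"
      using C(1) d by real_asymp
    then have "\<forall>\<^sub>F N::nat in sequentially. 2 * (real n0 + 1) \<le> (real N / C) powr (1 / real d)"
      by (simp add: filterlim_at_top)
    then show ?thesis
    proof eventually_elim
      case (elim N)
      define r where "r = (real N / C) powr (1 / real d)"
      define R where "R = nat \<lfloor>r\<rfloor>"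
      have r: "2 * (real n0 + 1) \<le> r" using elim by (simp add: r_def)
      have "real R = of_int \<lfloor>r\<rfloor>" using r unfolding R_def by simp
      then have R: "real R \<le> r" "r - 1 < real R" by linarith+
      have sub: "(\<lambda>n. poly f (int n)) ` {n0..R} \<subseteq> values_upto f N"
      proof clarify
        fix n assume n: "n \<in> {n0..R}"
        then have n1: "n \<ge> 1" by (simp add: n0_def)
        have "real n \<le> r" using n R(1) by auto
        then have "real n ^ d \<le> r ^ d" by (intro power_mono) auto
        also have "r ^ d = r powr real d" using r by (subst powr_realpow) auto
        also have "\<dots> = real N / C" using d C(1) by (simp add: r_def powr_powr)
        finally have "C * real n ^ d \<le> real N" using C(1) by (simp add: field_simps)
        then have "real_of_int (poly f (int n)) \<le> real N" using C(2)[OF n1] by linarith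
        then have "poly f (int n) \<le> int N" by linarith
        then show "poly f (int n) \<in> values_upto f N"
          using n1 f_pos[of n] n unfolding values_upto_def by auto
      qed
      have fin: "finite (values_upto f N)" by (simp add: values_upto_def)
      have fibre: "card {n\<in>{n0..R}. poly f (int n) = v} \<le> d" for v
      proof -
        define p where "p = f - [:v:]"
        have deg: "degree p = d"
          using degree_add_eq_left[of "- [:v:]" f] assms(1) unfolding p_def d_def diff_conv_add_uminus by simp
        then have "p \<noteq> 0" using d by auto
        have "card {n\<in>{n0..R}. poly f (int n) = v} \<le> card {x. poly p x = 0}"
          using poly_roots_finite[OF \<open>p \<noteq> 0\<close>]
          by (intro card_inj_on_le[where f = int]) (auto simp: p_def)
        also have "\<dots> \<le> d" using card_poly_roots_bound[OF \<open>p \<noteq> 0\<close>] deg by simp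
        finally show ?thesis .
      qed
      have "card {n0..R} = (\<Sum>v\<in>(\<lambda>n. poly f (int n)) ` {n0..R}. card {n\<in>{n0..R}. poly f (int n) = v})"
        unfolding card_eq_sum by (rule sum.image_gen) simp
      also have "\<dots> \<le> (\<Sum>v\<in>(\<lambda>n. poly f (int n)) ` {n0..R}. d)" by (intro sum_mono fibre)
      also have "\<dots> \<le> card (values_upto f N) * d" using card_mono[OF fin sub] by simp
      finally have "real (card {n0..R}) \<le> real (card (values_upto f N)) * real d"
        by (metis of_nat_le_iff of_nat_mult)
      moreover have "r / 2 \<le> real (card {n0..R})" using r R by simp
      ultimately have "r / 2 \<le> real (card (values_upto f N)) * real d" by linarith
      then have "r / (2 * real d) \<le> real (card (values_upto f N))" using d by (simp add: field_simps)
      moreover have "r / (2 * real d) = c * real N powr (1 / real d)"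
        using C(1) by (simp add: r_def c_def powr_divide)
      ultimately show ?case by simp
    qed
  qed
  ultimately show ?thesis using that unfolding d_def by blast
qed

theorem theorem3p1:
  fixes \<eta> \<mu> A :: real and f :: "int poly" and d :: nat
  assumes "0 < \<eta>" "\<eta> \<le> 1" "0 < \<mu>" "\<mu> \<le> 1" "A > 0"
    and "shrinking \<eta> \<mu> f"
    and "degree f = d" "d \<ge> 1" "lead_coeff f > 0"
  shows "\<exists>\<epsilon> :: nat \<Rightarrow> real. \<epsilon> \<longlonglongrightarrow> 0 \<and>
    (\<forall>\<^sub>F N in sequentially.
      real (H A N (values_upto f N)) \<ge>
        (1 + \<epsilon> N) * (((1 - \<mu>)\<^sup>2 * \<eta>\<^sup>2 / 200) * real N powr (2 / real d) / ln (real N) powr (A + 2)))"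
proof (intro exI[of _ "\<lambda>_. 0"] conjI tendsto_const)
  define C' where "C' = (1 - \<mu>)\<^sup>2 * \<eta>\<^sup>2 / 200"
  have "\<forall>\<^sub>F N in sequentially. C' * real N powr (2 / real d) / ln (real N) powr (A + 2) \<le> real (H A N (values_upto f N))"
  proof (cases "\<mu> = 1")
    case True
    then show ?thesis by (simp add: C'_def)
  next
    case False
    then have \<mu>: "\<mu> < 1" using assms(4) by simp
    have C': "C' > 0" using \<mu> assms(1) by (simp add: C'_def)
    obtain c where c: "c > 0"
      and ev_c: "\<forall>\<^sub>F N in sequentially. c * real N powr (1 / real d) \<le> real (card (values_upto f N))"
      using card_values_upto_ge[of f] assms(7-9) by auto
    \<comment> \<open>With \<open>K = \<delta> * ln N\<close> the cover bound reads \<open>c^2 * N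
      powr (2 / d) \<le> 2 * \<delta>^2 * ln N powr (A + 2) * H\<close>; this
      \<open>\<delta>\<close> makes \<open>c^2 / (2 * \<delta>^2)\<close> equal to
      \<open>C'\<close>. It requires \<open>C' > 0\<close>, hence the separate treatment of
      \<open>\<mu> = 1\<close>.\<close>
    define \<delta> where "\<delta> = c / sqrt (2 * C')"
    have \<delta>: "\<delta> > 0" "c\<^sup>2 = C' * (2 * \<delta>\<^sup>2)" using c C' by (auto simp: \<delta>_def power_divide)
    have ev_ln: "\<forall>\<^sub>F N::nat in sequentially. 1 \<le> ln (real N)" by real_asymp
    show ?thesis
      using ev_c ev_ln card_values_progression_le[OF assms(6,1,2,3) \<mu> \<delta>(1)]
    proof eventually_elim
      case (elim N)
      define l where "l = ln (real N)"
      have l: "l \<ge> 1" using elim(2) by (simp add: l_def)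
      have "values_upto f N \<subseteq> {1..int N}" "values_upto f N \<subseteq> range (poly f)"
        by (auto simp: values_upto_def)
      from H_attained[OF this(1), of A] obtain T X where TX: "qp_cover A N (values_upto f N) T X"
        "H A N (values_upto f N) = T * (\<Sum>i=1..T. card (X i))" by blast
      have "(c * real N powr (1 / real d))\<^sup>2 \<le> (real (card (values_upto f N)))\<^sup>2"
        using elim(1) c by (intro power_mono) auto
      also have "\<dots> \<le> 2 * (\<delta> * l)\<^sup>2 * l powr A * real (H A N (values_upto f N))"
        unfolding TX(2) l_def
        using elim(3) \<delta>(1) l assms(5)
        by (intro cover_bound[OF TX(1) \<open>values_upto f N \<subseteq> range (poly f)\<close>]) (auto simp: l_def)
      also have "2 * (\<delta> * l)\<^sup>2 * l powr A = 2 * \<delta>\<^sup>2 * l powr (A + 2)"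
        using l by (simp add: powr_add power_mult_distrib powr_numeral)
      also have "(c * real N powr (1 / real d))\<^sup>2 = 2 * \<delta>\<^sup>2 * (C' * real N powr (2 / real d))"
        by (simp add: power_mult_distrib \<delta>(2) powr_powr flip: powr_numeral)
      finally have "C' * real N powr (2 / real d) \<le> l powr (A + 2) * real (H A N (values_upto f N))"
        using \<delta>(1) by (simp add: mult.assoc)
      then show ?case using l by (simp add: l_def field_simps)
    qed
  qed
  then show "\<forall>\<^sub>F N in sequentially. real (H A N (values_upto f N)) \<ge>
      (1 + 0) * (((1 - \<mu>)\<^sup>2 * \<eta>\<^sup>2 / 200) * real N powr (2 / real d) / ln (real N) powr (A + 2))"
    by (simp add: C'_def)
qed

end
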